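(* Assume $\mathbf{b}=\omega_1$. Then over every infinite field $F$ there exists a Gross space of dimension $\aleph_1$.
   Context: A symmetric bilinear space over a field $F$ is a vector space $E$ over $F$ with a symmetric bilinear form $\Phi:E\times E\to F$. For a subspace $U\subseteq E$, $U^\perp=\{x\in E:\Phi(x,y)=0 \text{ for all } y\in U\}$. A Gross space is a symmetric bilinear space $\langle E,\Phi\rangle$ of infinite dimension such that every infinite-dimensional subspace $U\subseteq E$ satisfies $\dim U^\perp<\dim E$. For $f,g\in{}^\omega\omega$, $g<^* f$ means $g(n)<f(n)$ for all but finitely many $n$; $\mathbf{b}$ is the minimal cardinality of a family $\mathcal F\subseteq{}^\omega\omega$ such that no single $f\in{}^\omega\omega$ satisfies $g<^*f$ for all $g\in\mathcal F$. *)

theory Defs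
  imports Complex_Main "HOL-Library.Function_Algebras"
begin

unbundle cardinal_syntax

definition aleph1 :: "nat set rel"
  where "aleph1 = cardSuc natLeq"


subsection \<open>The bounding number\<close>

definition eventually_less :: "(nat \<Rightarrow> nat) \<Rightarrow> (nat \<Rightarrow> nat) \<Rightarrow> bool" (infix \<open><**\<close> 50)
  where "g <** f \<longleftrightarrow> finite {n. \<not> g n < f n}"

definition unbounded_family :: "(nat \<Rightarrow> nat) set \<Rightarrow> bool"
  where "unbounded_family \<F> \<longleftrightarrow> \<not> (\<exists>f. \<forall>g\<in>\<F>. g <** f)"

definition bounding_number :: "(nat \<Rightarrow> nat) rel"
  where "bounding_number =
    |SOME \<F>. unbounded_family \<F> \<and> (\<forall>\<G>. unbounded_family \<G> \<longrightarrow> |\<F>| \<le>o |\<G>| )|"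

lemma unbounded_family_UNIV: "unbounded_family UNIV"
proof -
  have "\<not> f <** f" for f :: "nat \<Rightarrow> nat"
    by (simp add: eventually_less_def)
  then show ?thesis
    by (auto simp: unbounded_family_def)
qed

lemma bounding_number_minimal:
  "\<exists>\<F>. unbounded_family \<F> \<and> bounding_number = |\<F>|"
  "unbounded_family \<G> \<Longrightarrow> bounding_number \<le>o |\<G>|"
proof -
  let ?P = "\<lambda>\<F>. unbounded_family \<F> \<and> (\<forall>\<G>. unbounded_family \<G> \<longrightarrow> |\<F>| \<le>o |\<G>| )"
  let ?R = "{ |\<F>| | \<F>. unbounded_family \<F>}"
  have "?R \<noteq> {}" "\<forall>r\<in>?R. Card_order r"
    using unbounded_family_UNIV card_of_Card_order by blast+
  from exists_minim_Card_order[OF this] have "\<exists>\<F>. ?P \<F>"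
    by blast
  then have "?P (SOME \<F>. ?P \<F>)"
    by (rule someI_ex)
  then show "\<exists>\<F>. unbounded_family \<F> \<and> bounding_number = |\<F>|"
    and "unbounded_family \<G> \<Longrightarrow> bounding_number \<le>o |\<G>|"
    unfolding bounding_number_def by blast+
qed


subsection \<open>Dimension as a cardinal\<close>

text \<open>The library's \<open>dim\<close> is a natural number, with value 0 for every
  infinite-dimensional space.\<close>

definition card_dim :: "('a::field \<Rightarrow> 'b::ab_group_add \<Rightarrow> 'b) \<Rightarrow> 'b set \<Rightarrow> 'b rel"
  where "card_dim scale V =
    |SOME B. \<not> module.dependent scale B \<and> module.span scale B = module.span scale V|"

lemma (in vector_space) card_dim_eq:
  assumes "independent B" "span B = span V"
  shows "card_dim scale V =o |B|"
proof -
  let ?C = "SOME B. independent B \<and> span B = span V"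
  have "independent ?C \<and> span ?C = span V"
    by (rule someI[of "\<lambda>B. independent B \<and> span B = span V" B]) (use assms in simp)
  then obtain f where "bij_betw f ?C B"
    using bij_if_span_eq_span_bases[of ?C B] assms by auto
  then show ?thesis
    unfolding card_dim_def using card_of_ordIsoI by blast
qed


subsection \<open>Gross spaces\<close>

text \<open>The space is a subspace \<open>E\<close> of an ambient type, so that one can assert the
  existence of a space of a given dimension; \<open>\<Phi>\<close> is relevant only on \<open>E\<close>.\<close>

locale symmetric_bilinear_space = vector_space scale
  for scale :: "'a::field \<Rightarrow> 'b::ab_group_add \<Rightarrow> 'b" (infixr \<open>*s\<close> 75) +
  fixes E :: "'b set" and \<Phi> :: "'b \<Rightarrow> 'b \<Rightarrow> 'a"
  assumes subspace_E: "subspace E"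
    and Phi_sym: "\<lbrakk>x \<in> E; y \<in> E\<rbrakk> \<Longrightarrow> \<Phi> x y = \<Phi> y x"
    and Phi_add_left: "\<lbrakk>x \<in> E; y \<in> E; z \<in> E\<rbrakk> \<Longrightarrow> \<Phi> (x + y) z = \<Phi> x z + \<Phi> y z"
    and Phi_scale_left: "\<lbrakk>x \<in> E; y \<in> E\<rbrakk> \<Longrightarrow> \<Phi> (c *s x) y = c * \<Phi> x y"
begin

definition perp :: "'b set \<Rightarrow> 'b set"
  where "perp U = {x \<in> E. \<forall>y\<in>U. \<Phi> x y = 0}"

end

locale gross_space = symmetric_bilinear_space scale E \<Phi>
  for scale :: "'a::field \<Rightarrow> 'b::ab_group_add \<Rightarrow> 'b" (infixr \<open>*s\<close> 75) and E \<Phi> +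
  assumes infinite_dim: "cinfinite (card_dim scale E)"
    and perp_small:
      "\<lbrakk>subspace U; U \<subseteq> E; cinfinite (card_dim scale U)\<rbrakk> \<Longrightarrow> card_dim scale (perp U) <o card_dim scale E"


subsection \<open>A universe for spaces of dimension \<open>\<aleph>\<^sub>1\<close>\<close>

text \<open>Every vector space of dimension \<open>\<aleph>\<^sub>1\<close> over \<open>'a\<close> is isomorphic to a subspace of
  \<open>nat set \<Rightarrow> 'a\<close>: its basis injects into \<open>nat set\<close>, and a vector is sent to its
  finitely supported coordinate function. Hence existence of a space with given
  properties can be stated over this type without loss of generality.\<close>

definition fun_scale :: "'a::field \<Rightarrow> ('i \<Rightarrow> 'a) \<Rightarrow> 'i \<Rightarrow> 'a"
  where "fun_scale c v = (\<lambda>i. c * v i)"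

lemma vector_space_fun_scale: "vector_space fun_scale"
  by unfold_locales (auto simp: fun_scale_def fun_eq_iff algebra_simps)

end

theory Submission
  imports Defs "HOL-Library.Countable_Set_Type"
begin

text \<open>The form is determined by \<open>\<Phi>(e\<^sub>a, e\<^sub>b) = \<mu> (F\<^sub>a b)\<close> for \<open>b < a < \<omega>\<^sub>1\<close>, where \<open>\<mu>\<close> is a sequence in
  the field that is generic for polynomials: a nonconstant affine function of \<open>\<mu> n\<close> whose
  coefficients are given by a fixed polynomial in earlier terms of \<open>\<mu>\<close> does not vanish once \<open>n\<close> is
  large. This is achieved by diagonalization even over an uncountable field, because polynomials
  have only countably many zero sets on a countable set of points. The injections \<open>F\<^sub>a\<close> from \<open>a\<close> to
  the natural numbers are chosen by recursion, growing faster than the earlier ones and than the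
  \<open>a\<close>-th member of an unbounded family of length \<open>\<omega>\<^sub>1\<close>.

  An infinite-dimensional \<open>U\<close> contains nonzero vectors, with supports in a fixed countable \<open>d\<close>, that
  vanish on any given finite subset of \<open>d\<close>. These determine a function \<open>g\<close> bounding the indices at
  which genericity sets in. For all \<open>a\<close> beyond some countable \<open>d'\<close>, the injection \<open>F\<^sub>a\<close> escapes \<open>g\<close>
  infinitely often, and by Gaussian elimination the functionals \<open>\<Phi>(e\<^sub>a, -)\<close> with \<open>a \<ge> d'\<close> are
  linearly independent on \<open>U\<close>. So the projection of the orthogonal complement of \<open>U\<close> to the
  coordinates below \<open>d'\<close> is injective.\<close>

section \<open>Linear algebra in function spaces\<close>

interpretation fs: vector_space "fun_scale :: 'a::field \<Rightarrow> ('i \<Rightarrow> 'a) \<Rightarrow> 'i \<Rightarrow> 'a"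
  by (rule vector_space_fun_scale)

interpretation fsp: vector_space_pair "fun_scale :: 'a::field \<Rightarrow> ('i \<Rightarrow> 'a) \<Rightarrow> 'i \<Rightarrow> 'a"
    "fun_scale :: 'a::field \<Rightarrow> ('i \<Rightarrow> 'a) \<Rightarrow> 'i \<Rightarrow> 'a"
  by unfold_locales

lemma fun_scale_apply [simp]: "fun_scale c v i = c * v i"
  by (simp add: fun_scale_def)

lemma sum_fun_apply: "(\<Sum>i\<in>A. f i) x = (\<Sum>i\<in>A. f i x)"
  for f :: "'b \<Rightarrow> 'c \<Rightarrow> 'd::comm_monoid_add"
  by (induction A rule: infinite_finite_induct) auto

definition unit_fun :: "'i \<Rightarrow> 'i \<Rightarrow> 'a::field"
  where "unit_fun i = (\<lambda>j. if j = i then 1 else 0)"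

definition supp :: "('i \<Rightarrow> 'a::zero) \<Rightarrow> 'i set"
  where "supp v = {i. v i \<noteq> 0}"

lemma not_in_supp: "i \<notin> supp v \<longleftrightarrow> v i = 0"
  by (simp add: supp_def)

lemma inj_unit_fun: "inj (unit_fun :: 'i \<Rightarrow> 'i \<Rightarrow> 'a::field)"
  by (rule injI) (metis unit_fun_def zero_neq_one)

lemma span_unit_fun:
  "fs.span (unit_fun ` A) = {v :: 'i \<Rightarrow> 'a::field. finite (supp v) \<and> supp v \<subseteq> A}"
proof (intro set_eqI iffI)
  fix v :: "'i \<Rightarrow> 'a"
  assume "v \<in> fs.span (unit_fun ` A)"
  then show "v \<in> {v. finite (supp v) \<and> supp v \<subseteq> A}"
  proof (induction rule: fs.span_induct_alt)
    case base
    show ?case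
      by (simp add: supp_def)
  next
    case (step c x y)
    then obtain i where i: "i \<in> A" "x = unit_fun i"
      by blast
    then have "supp (fun_scale c x + y) \<subseteq> insert i (supp y)"
      by (auto simp: supp_def unit_fun_def split: if_splits)
    moreover have "finite (insert i (supp y))" "insert i (supp y) \<subseteq> A"
      using step(2) i by auto
    ultimately show ?case
      using finite_subset by blast
  qed
next
  fix v :: "'i \<Rightarrow> 'a"
  assume "v \<in> {v. finite (supp v) \<and> supp v \<subseteq> A}"
  then have v: "finite (supp v)" "supp v \<subseteq> A"
    by auto
  have "v = (\<Sum>i\<in>supp v. fun_scale (v i) (unit_fun i))"
    using v(1) by (auto simp: fun_eq_iff sum_fun_apply unit_fun_def not_in_supp if_distrib cong: if_cong)
  also have "\<dots> \<in> fs.span (unit_fun ` A)"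
    using v(2) by (intro fs.span_sum fs.span_scale fs.span_base) auto
  finally show "v \<in> fs.span (unit_fun ` A)" .
qed

lemma independent_unit_fun: "fs.independent (unit_fun ` A :: ('i \<Rightarrow> 'a::field) set)"
  unfolding fs.dependent_def
proof safe
  fix i
  assume "unit_fun i \<in> fs.span (unit_fun ` A - {unit_fun i :: 'i \<Rightarrow> 'a})"
  also have "unit_fun ` A - {unit_fun i :: 'i \<Rightarrow> 'a} = unit_fun ` (A - {i})"
    by (simp add: image_set_diff[OF inj_unit_fun])
  finally have "i \<notin> supp (unit_fun i :: 'i \<Rightarrow> 'a)"
    unfolding span_unit_fun by blast
  then show False
    by (simp add: supp_def unit_fun_def)
qed

text \<open>Restriction to \<open>A\<close> is linear and injective on the span, so it carries
  \<open>B\<close> to an independent set in the span of the unit vectors of \<open>A\<close>, and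
  bases of that span are equinumerous. This serves to bound an orthogonal complement and to find
  nonzero vectors vanishing at finitely many coordinates.\<close>

lemma independent_card_le:
  fixes B :: "('i \<Rightarrow> 'a::field) set"
  assumes B: "fs.independent B"
    and fin: "\<And>v. v \<in> B \<Longrightarrow> finite (supp v)"
    and inj: "\<And>v. \<lbrakk>v \<in> fs.span B; \<And>i. i \<in> A \<Longrightarrow> v i = 0\<rbrakk> \<Longrightarrow> v = 0"
  shows "|B| \<le>o |A|"
proof -
  define r :: "('i \<Rightarrow> 'a) \<Rightarrow> 'i \<Rightarrow> 'a" where "r v = (\<lambda>i. if i \<in> A then v i else 0)" for v
  have lin: "Vector_Spaces.linear fun_scale fun_scale r"
    unfolding Vector_Spaces.linear_iff using vector_space_fun_scale by (auto simp: r_def fun_eq_iff)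
  have "inj_on r (fs.span B)"
  proof (rule inj_onI)
    fix v w
    assume vw: "v \<in> fs.span B" "w \<in> fs.span B" "r v = r w"
    have "v - w = 0"
    proof (rule inj)
      show "v - w \<in> fs.span B"
        using vw by (intro fs.span_diff)
      show "(v - w) i = 0" if "i \<in> A" for i
        using fun_cong[OF vw(3), of i] that by (simp add: r_def)
    qed
    then show "v = w"
      by simp
  qed
  with B lin have ind: "fs.independent (r ` B)"
    by (intro fsp.linear_independent_injective_image)
  have sub: "r ` B \<subseteq> fs.span (unit_fun ` A)"
  proof safe
    fix v
    assume "v \<in> B"
    then have "finite (supp (r v))"
      by (intro finite_subset[OF _ fin]) (auto simp: r_def supp_def)
    then show "r v \<in> fs.span (unit_fun ` A)"
      unfolding span_unit_fun by (auto simp: r_def supp_def)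
  qed
  obtain C where C: "r ` B \<subseteq> C" "C \<subseteq> fs.span (unit_fun ` A)" "fs.independent C"
    "fs.span (unit_fun ` A) \<subseteq> fs.span C"
    using fs.maximal_independent_subset_extend[OF sub ind] by metis
  have "fs.span C = fs.span (unit_fun ` A)"
    using C fs.span_minimal[OF C(2)] by auto
  then obtain f where f: "bij_betw f C (unit_fun ` A :: ('i \<Rightarrow> 'a) set)"
    using fs.bij_if_span_eq_span_bases[OF C(3) independent_unit_fun] by blast
  have "|B| =o |r ` B|"
    using \<open>inj_on r (fs.span B)\<close> fs.span_superset[of B]
    by (intro card_of_ordIsoI[of r]) (auto simp: bij_betw_def intro: inj_on_subset)
  also have "|r ` B| \<le>o |C|"
    using C(1) by (rule card_of_mono1)
  also have "|C| =o |unit_fun ` A :: ('i \<Rightarrow> 'a) set|"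
    using f by (rule card_of_ordIsoI)
  also have "|unit_fun ` A :: ('i \<Rightarrow> 'a) set| \<le>o |A|"
    by (rule card_of_image)
  finally show ?thesis .
qed

section \<open>Sequences generic for polynomials\<close>

text \<open>A finite set \<open>S\<close> of functions maps \<open>Y\<close> into a finite-dimensional space, where a zero set
  becomes the trace of a subspace and so is spanned by finitely many of its points.\<close>

lemma countable_zero_sets:
  fixes Q :: "('y \<Rightarrow> 'a::field) set"
  assumes "countable Q" "countable Y"
  shows "countable ((\<lambda>h. {y \<in> Y. h y = 0}) ` fs.span Q)"
proof -
  define ev :: "('y \<Rightarrow> 'a) set \<Rightarrow> 'y \<Rightarrow> ('y \<Rightarrow> 'a) \<Rightarrow> 'a"
    where "ev S y = (\<lambda>m. if m \<in> S then m y else 0)" for S y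
  define Z where "Z = (\<lambda>(S, T). {y \<in> Y. ev S y \<in> fs.span (ev S ` T)})"
  have "\<exists>p\<in>{S. finite S \<and> S \<subseteq> Q} \<times> {T. finite T \<and> T \<subseteq> Y}. {y \<in> Y. h y = 0} = Z p"
    if h: "h \<in> fs.span Q" for h
  proof -
    obtain S c where S: "finite S" "S \<subseteq> Q" and hS: "h = (\<Sum>m\<in>S. fun_scale (c m) m)"
      using h unfolding fs.span_explicit by blast
    \<comment> \<open>\<open>L\<close> expresses \<open>h\<close> as a linear form in
      \<open>ev S y\<close>. It vanishes on the span of any zeros, and maximality of
      \<open>B\<close> puts every zero into the span of \<open>B\<close>.\<close>
    define L where "L v = (\<Sum>m\<in>S. c m * v m)" for v :: "('y \<Rightarrow> 'a) \<Rightarrow> 'a"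
    have L: "L (ev S y) = h y" for y
      unfolding L_def hS by (auto simp: sum_fun_apply ev_def intro: sum.cong)
    obtain B where B: "B \<subseteq> ev S ` {y \<in> Y. h y = 0}" "fs.independent B"
      "ev S ` {y \<in> Y. h y = 0} \<subseteq> fs.span B"
      by (rule fs.maximal_independent_subset)
    have supp_ev: "supp (ev S y) \<subseteq> S" for y
      by (auto simp: supp_def ev_def)
    have "B \<subseteq> fs.span (unit_fun ` S)"
    proof
      fix b
      assume "b \<in> B"
      then obtain y where "b = ev S y"
        using B(1) by blast
      then show "b \<in> fs.span (unit_fun ` S)"
        unfolding span_unit_fun using supp_ev finite_subset[OF supp_ev S(1)] by simp
    qed
    then have "finite B"
      using fs.independent_span_bound[OF _ B(2)] S(1) by blast
    then obtain T where T: "T \<subseteq> {y \<in> Y. h y = 0}" "finite T" "B = ev S ` T"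
      using finite_subset_image[OF _ B(1)] by blast
    have "{y \<in> Y. h y = 0} = Z (S, T)"
    proof
      show "{y \<in> Y. h y = 0} \<subseteq> Z (S, T)"
        using B(3) T by (auto simp: Z_def)
      show "Z (S, T) \<subseteq> {y \<in> Y. h y = 0}"
      proof
        fix y
        assume y: "y \<in> Z (S, T)"
        then have "ev S y \<in> fs.span (ev S ` T)"
          by (simp add: Z_def)
        then have "L (ev S y) = 0"
        proof (induction rule: fs.span_induct_alt)
          case base
          show ?case
            by (simp add: L_def)
        next
          case (step d v w)
          then have "L v = 0"
            using T(1) L by auto
          with step(2) show ?case
            by (simp add: L_def algebra_simps sum.distrib flip: sum_distrib_left)
        qed
        with y L show "y \<in> {y \<in> Y. h y = 0}"
          by (auto simp: Z_def)
      qed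
    qed
    with S T show ?thesis
      by blast
  qed
  then have "(\<lambda>h. {y \<in> Y. h y = 0}) ` fs.span Q
      \<subseteq> Z ` ({S. finite S \<and> S \<subseteq> Q} \<times> {T. finite T \<and> T \<subseteq> Y})"
    by blast
  moreover have "countable ({S. finite S \<and> S \<subseteq> Q} \<times> {T. finite T \<and> T \<subseteq> Y})"
    using assms by (intro countable_SIGMA countable_Collect_finite_subset)
  ultimately show ?thesis
    by (meson countable_image countable_subset)
qed

section \<open>Polynomial functions in countably many variables\<close>

definition monom_fun :: "nat list \<Rightarrow> (nat \<Rightarrow> 'a) \<Rightarrow> 'a::field"
  where "monom_fun l x = prod_list (map x l)"

text \<open>Monomials indexed by lists form a countable spanning set even over an uncountable field,
  as \<open>countable_zero_sets\<close> requires.\<close>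

definition poly_fun :: "((nat \<Rightarrow> 'a::field) \<Rightarrow> 'a) set"
  where "poly_fun = fs.span (range monom_fun)"

lemma poly_fun_const: "(\<lambda>x. c) \<in> poly_fun"
proof -
  have "fun_scale c (monom_fun []) \<in> poly_fun"
    unfolding poly_fun_def by (intro fs.span_scale fs.span_base) auto
  then show ?thesis
    by (simp add: monom_fun_def fun_scale_def)
qed

lemma poly_fun_var: "(\<lambda>x :: nat \<Rightarrow> 'a::field. x v) \<in> poly_fun"
proof -
  have "monom_fun [v] \<in> (poly_fun :: ((nat \<Rightarrow> 'a) \<Rightarrow> 'a) set)"
    unfolding poly_fun_def by (intro fs.span_base) auto
  moreover have "monom_fun [v] = (\<lambda>x :: nat \<Rightarrow> 'a. x v)"
    by (simp add: monom_fun_def fun_eq_iff)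
  ultimately show ?thesis
    by simp
qed

lemma poly_fun_add: "\<lbrakk>p \<in> poly_fun; q \<in> poly_fun\<rbrakk> \<Longrightarrow> (\<lambda>x. p x + q x) \<in> poly_fun"
  unfolding poly_fun_def using fs.span_add[of p _ q] by (simp add: plus_fun_def)

lemma poly_fun_scale: "p \<in> poly_fun \<Longrightarrow> (\<lambda>x. c * p x) \<in> poly_fun"
  unfolding poly_fun_def using fs.span_scale[of p _ c] by (simp add: fun_scale_def)

lemma poly_fun_mult:
  assumes "p \<in> poly_fun" "q \<in> poly_fun"
  shows "(\<lambda>x. p x * q x) \<in> poly_fun"
proof -
  have mono: "(\<lambda>x. monom_fun l x * q x) \<in> poly_fun" for l
    using assms(2)[unfolded poly_fun_def]
  proof (induction rule: fs.span_induct_alt)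
    case base
    show ?case
      using poly_fun_const[of 0] by simp
  next
    case (step c r s)
    then obtain l' where r: "r = monom_fun l'"
      by blast
    have "monom_fun (l @ l') \<in> poly_fun"
      unfolding poly_fun_def by (intro fs.span_base) auto
    then have "(\<lambda>x. c * monom_fun (l @ l') x + monom_fun l x * s x) \<in> poly_fun"
      using step(2) by (intro poly_fun_add poly_fun_scale)
    moreover have "(\<lambda>x. c * monom_fun (l @ l') x + monom_fun l x * s x)
        = (\<lambda>x. monom_fun l x * (fun_scale c r + s) x)"
      by (simp add: fun_eq_iff r monom_fun_def algebra_simps)
    ultimately show ?case
      by simp
  qed
  show ?thesis
    using assms(1)[unfolded poly_fun_def]
  proof (induction rule: fs.span_induct_alt)
    case base
    show ?case
      using poly_fun_const[of 0] by simp
  next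
    case (step c r s)
    then have "(\<lambda>x. r x * q x) \<in> poly_fun"
      using mono by auto
    then have "(\<lambda>x. c * (r x * q x) + s x * q x) \<in> poly_fun"
      using step(2) by (intro poly_fun_add poly_fun_scale)
    moreover have "(\<lambda>x. c * (r x * q x) + s x * q x) = (\<lambda>x. (fun_scale c r + s) x * q x)"
      by (simp add: fun_eq_iff algebra_simps)
    ultimately show ?case
      by simp
  qed
qed

lemma poly_fun_diff:
  assumes "p \<in> poly_fun" "q \<in> poly_fun"
  shows "(\<lambda>x. p x - q x) \<in> poly_fun"
  using poly_fun_add[OF assms(1) poly_fun_scale[OF assms(2), of "-1"]] by simp

lemma poly_fun_sum:
  "(\<And>i. i \<in> A \<Longrightarrow> p i \<in> poly_fun) \<Longrightarrow> (\<lambda>x. \<Sum>i\<in>A. p i x) \<in> poly_fun"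
  by (induction A rule: infinite_finite_induct) (auto intro: poly_fun_const poly_fun_add)

text \<open>Each monomial involves finitely many variables. This permits truncating an assignment,
  so that the diagonalization meets only countably many points.\<close>

lemma poly_fun_finite_vars:
  assumes "p \<in> poly_fun"
  shows "\<exists>L. \<forall>x y. (\<forall>v<L. x v = y v) \<longrightarrow> p x = p y"
  using assms unfolding poly_fun_def
proof (induction rule: fs.span_induct_alt)
  case base
  show ?case
    by simp
next
  case (step c r s)
  then obtain l where r: "r = monom_fun l"
    by blast
  obtain L where L: "\<forall>x y. (\<forall>v<L. x v = y v) \<longrightarrow> s x = s y"
    using step by blast
  have "(fun_scale c r + s) x = (fun_scale c r + s) y"
    if xy: "\<forall>v<max L (Suc (Max (set l))). x v = y v" for x y
  proof -
    have "v < Suc (Max (set l))" if "v \<in> set l" for v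
      using that by (simp add: less_Suc_eq_le)
    then have "map x l = map y l"
      using xy by (intro map_cong) (auto simp: less_max_iff_disj)
    then have "r x = r y"
      by (simp only: r monom_fun_def)
    moreover have "s x = s y"
      using L xy by auto
    ultimately show ?thesis
      by simp
  qed
  then show ?case
    by blast
qed

text \<open>\<open>Z n\<close> enumerates the zero sets of polynomials on the countable set \<open>Y\<close> of points considered,
  and \<open>\<rho> n\<close> bounds the finitely many roots arising from the first \<open>n\<close> of them.\<close>

lemma generic_sequence_exists:
  assumes "infinite (UNIV :: 'a::field set)"
  shows "\<exists>\<mu> :: nat \<Rightarrow> 'a. \<forall>p\<in>poly_fun. \<forall>v. \<exists>N. \<forall>n\<ge>N. \<forall>\<tau>.
    (\<forall>w. w \<noteq> v \<longrightarrow> \<tau> w < n) \<longrightarrow> finite {z. p ((\<mu> \<circ> \<tau>)(v := z)) = 0}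
      \<longrightarrow> p ((\<mu> \<circ> \<tau>)(v := \<mu> n)) \<noteq> 0"
proof -
  obtain q :: "nat \<Rightarrow> 'a" where q: "inj q"
    using infinite_countable_subset[OF assms] by blast
  \<comment> \<open>Points with coordinates in the range of \<open>q\<close>, all but finitely many
    equal to \<open>q 0\<close>; coding by lists makes \<open>Y\<close> countable.\<close>
  define Y where "Y = range (\<lambda>s. q \<circ> (\<lambda>v. if v < length s then s ! v else 0))"
  have Y: "q \<circ> \<tau> \<in> Y" if "\<And>v. v \<ge> n \<Longrightarrow> \<tau> v = 0" for \<tau> n
    unfolding Y_def by (rule range_eqI[of _ _ "map \<tau> [0..<n]"]) (auto simp: fun_eq_iff that)
  define ZZ :: "(nat \<Rightarrow> 'a) set set" where "ZZ = (\<lambda>h. {y \<in> Y. h y = 0}) ` poly_fun"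
  have "countable ZZ"
    unfolding ZZ_def poly_fun_def Y_def by (rule countable_zero_sets) auto
  then obtain Z :: "nat \<Rightarrow> (nat \<Rightarrow> 'a) set" where Z: "ZZ \<subseteq> range Z"
    using that[OF subset_range_from_nat_into[of ZZ]] by simp
  define T where "T n = {\<tau>. (\<forall>v. \<tau> v \<le> n) \<and> (\<forall>v\<ge>n. \<tau> v = (0::nat))}" for n :: nat
  have finT: "finite (T n)" for n
  proof (rule finite_subset)
    show "T n \<subseteq> (\<lambda>s v. if v < length s then s ! v else 0) ` {s. set s \<subseteq> {..n} \<and> length s = n}"
    proof
      fix \<tau>
      assume \<tau>: "\<tau> \<in> T n"
      then have "\<tau> = (\<lambda>v. if v < length (map \<tau> [0..<n]) then map \<tau> [0..<n] ! v else 0)"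
        by (auto simp: fun_eq_iff T_def)
      moreover have "map \<tau> [0..<n] \<in> {s. set s \<subseteq> {..n} \<and> length s = n}"
        using \<tau> by (auto simp: T_def)
      ultimately show "\<tau> \<in> (\<lambda>s v. if v < length s then s ! v else 0) ` {s. set s \<subseteq> {..n} \<and> length s = n}"
        by blast
    qed
  qed (intro finite_imageI finite_lists_length_eq finite_atMost)
  \<comment> \<open>Roots in the variable \<open>v\<close> are recorded by their indices under
    \<open>q\<close>, the other variables being fixed at \<open>q \<circ> \<tau>\<close>.\<close>
  define R where "R e v \<tau> = {t. (q \<circ> \<tau>)(v := q t) \<in> Z e}" for e v \<tau>
  define RR where "RR n = (\<Union>e\<le>n. \<Union>v\<le>n. \<Union>\<tau>\<in>T n. if finite (R e v \<tau>) then R e v \<tau> else {})"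
    for n
  have "finite (RR n)" for n
    using finT by (simp add: RR_def)
  then have "\<forall>n. \<exists>b. \<forall>t\<in>RR n. t < b"
    using finite_nat_set_iff_bounded by blast
  then obtain \<rho> where \<rho>': "\<And>n. \<forall>t\<in>RR n. t < \<rho> n"
    by metis
  have \<rho>: "t < \<rho> n" if "e \<le> n" "v \<le> n" "\<tau> \<in> T n" "finite (R e v \<tau>)" "t \<in> R e v \<tau>"
    for n e v \<tau> t
  proof -
    have "t \<in> RR n"
      unfolding RR_def using that by auto
    then show ?thesis
      using \<rho>' by blast
  qed
  \<comment> \<open>The sequence will be \<open>q \<circ> r\<close>, where each value of
    \<open>r\<close> jumps past the bound on all roots determined by indices up to the previous
    value.\<close>
  define r where "r n = ((\<lambda>x. Suc (max (\<rho> x) x)) ^^ n) 0" for n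
  have r_Suc: "r (Suc n) = Suc (max (\<rho> (r n)) (r n))" for n
    by (simp add: r_def)
  have r_mono: "r m \<le> r n" if "m \<le> n" for m n
    by (rule lift_Suc_mono_le[OF _ that]) (simp add: r_Suc)
  have r_ge: "n \<le> r n" for n
    by (induction n) (auto simp: r_Suc le_max_iff_disj)
  show ?thesis
  proof (intro exI[of _ "q \<circ> r"] ballI allI)
    fix p :: "(nat \<Rightarrow> 'a) \<Rightarrow> 'a" and v
    assume p: "p \<in> poly_fun"
    then obtain L where L: "\<And>x y. (\<forall>v<L. x v = y v) \<Longrightarrow> p x = p y"
      using poly_fun_finite_vars by meson
    have "{y \<in> Y. p y = 0} \<in> ZZ"
      using p by (auto simp: ZZ_def)
    then obtain e where e: "Z e = {y \<in> Y. p y = 0}"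
      using Z by blast
    \<comment> \<open>The successor gives \<open>n\<close> a predecessor \<open>n'\<close> above
      \<open>e\<close>, \<open>v\<close> and \<open>L\<close>; the roots bounded at stage
      \<open>r n'\<close> then lie below \<open>r n\<close>.\<close>
    define N where "N = Suc (max e (max v L))"
    show "\<exists>N. \<forall>n\<ge>N. \<forall>\<tau>. (\<forall>w. w \<noteq> v \<longrightarrow> \<tau> w < n)
      \<longrightarrow> finite {z. p ((q \<circ> r \<circ> \<tau>)(v := z)) = 0} \<longrightarrow> p ((q \<circ> r \<circ> \<tau>)(v := (q \<circ> r) n)) \<noteq> 0"
    proof (intro exI[of _ N] allI impI)
      fix n \<tau>
      assume n: "N \<le> n" and \<tau>: "\<forall>w. w \<noteq> v \<longrightarrow> \<tau> w < n"
        and fin: "finite {z. p ((q \<circ> r \<circ> \<tau>)(v := z)) = 0}"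
      then obtain n' where n': "n = Suc n'" "e \<le> n'" "v \<le> n'" "L \<le> n'"
        unfolding N_def by (cases n) auto
      \<comment> \<open>Truncating to the variables that \<open>p\<close> sees places the assignment
        in the finite set \<open>T (r n')\<close>. The value 0 at \<open>v\<close> is a placeholder
        that the update overwrites.\<close>
      define \<sigma> where "\<sigma> w = (if w < L \<and> w \<noteq> v then r (\<tau> w) else 0)" for w
      have p_eq: "p ((q \<circ> r \<circ> \<tau>)(v := z)) = p ((q \<circ> \<sigma>)(v := z))" for z
        by (rule L) (auto simp: \<sigma>_def)
      have "\<sigma> w \<le> r n'" for w
        using \<tau> r_mono[of "\<tau> w" n'] by (auto simp: \<sigma>_def n'(1) less_Suc_eq_le)
      then have \<sigma>: "\<sigma> \<in> T (r n')"
        using n'(4) r_ge[of n'] by (auto simp: T_def \<sigma>_def)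
      have "(q \<circ> \<sigma>)(v := q t) \<in> Y" for t
      proof -
        have "(q \<circ> \<sigma>)(v := q t) = q \<circ> (\<sigma>(v := t))"
          by auto
        moreover have "q \<circ> (\<sigma>(v := t)) \<in> Y"
          by (rule Y[of "Suc (max L v)"]) (auto simp: \<sigma>_def)
        ultimately show ?thesis
          by simp
      qed
      then have R: "R e v \<sigma> = {t. p ((q \<circ> \<sigma>)(v := q t)) = 0}"
        by (auto simp: R_def e)
      have "finite (R e v \<sigma>)"
        using finite_vimageI[OF fin q] by (simp add: R p_eq vimage_def)
      then have "r n \<notin> R e v \<sigma>"
        using \<rho>[OF _ _ \<sigma>, of e v "r n"] n' r_ge[of n'] by (auto simp: r_Suc)
      then show "p ((q \<circ> r \<circ> \<tau>)(v := (q \<circ> r) n)) \<noteq> 0"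
        by (simp add: R p_eq)
    qed
  qed
qed

section \<open>Elimination\<close>

text \<open>\<open>x\<close> is a matrix with rows \<open>i\<close> and columns \<open>c\<close>;
  packing the pair into one index turns its entries into variables of
  \<open>poly_fun\<close>.\<close>

definition row_eval :: "(nat \<Rightarrow> 'a::field) \<Rightarrow> nat \<Rightarrow> (nat \<Rightarrow> 'a) \<Rightarrow> 'a"
  where "row_eval x i v = (\<Sum>c\<in>supp v. v c * x (prod_encode (i, c)))"

text \<open>Division-free Gaussian elimination: the entry of \<open>ps\<close> at distance \<open>i\<close> from the end is the
  index of the vector \<open>b p\<close> used as pivot for the functional \<open>row_eval x i\<close>, and the result lies
  in the kernel of the first \<open>length ps\<close> functionals.\<close>

fun elim :: "(nat \<Rightarrow> nat \<Rightarrow> 'a::field) \<Rightarrow> (nat \<Rightarrow> 'a) \<Rightarrow> nat list \<Rightarrow> (nat \<Rightarrow> 'a) \<Rightarrow> nat \<Rightarrow> 'a"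
  where
    "elim b x [] w = w"
  | "elim b x (p # ps) w = (\<lambda>c. row_eval x (length ps) (elim b x ps (b p)) * elim b x ps w c
      - row_eval x (length ps) (elim b x ps w) * elim b x ps (b p) c)"

text \<open>The factor by which \<open>elim\<close> rescales coordinates outside the supports of the
  pivot vectors; it is nonzero exactly when all pivots are.\<close>

fun pivot_prod :: "(nat \<Rightarrow> nat \<Rightarrow> 'a::field) \<Rightarrow> (nat \<Rightarrow> 'a) \<Rightarrow> nat list \<Rightarrow> 'a"
  where
    "pivot_prod b x [] = 1"
  | "pivot_prod b x (p # ps) = row_eval x (length ps) (elim b x ps (b p)) * pivot_prod b x ps"

lemma row_eval_eq_sum:
  assumes "finite D" "supp v \<subseteq> D"
  shows "row_eval x i v = (\<Sum>c\<in>D. v c * x (prod_encode (i, c)))"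
  unfolding row_eval_def using assms by (intro sum.mono_neutral_left) (auto simp: supp_def)

lemma row_eval_diff:
  assumes "finite (supp v)" "finite (supp w)"
  shows "row_eval x i (\<lambda>c. s * v c - t * w c) = s * row_eval x i v - t * row_eval x i w"
proof -
  have "supp (\<lambda>c. s * v c - t * w c) \<subseteq> supp v \<union> supp w"
    by (auto simp: supp_def)
  with assms show ?thesis
    by (subst (1 2 3) row_eval_eq_sum[of "supp v \<union> supp w"])
      (auto simp: sum_distrib_left algebra_simps sum_subtractf)
qed

lemma supp_elim: "supp (elim b x ps w) \<subseteq> supp w \<union> (\<Union>p\<in>set ps. supp (b p))"
proof (induction ps arbitrary: w)
  case (Cons p ps)
  have "supp (elim b x (p # ps) w) \<subseteq> supp (elim b x ps w) \<union> supp (elim b x ps (b p))"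
    by (auto simp: supp_def)
  with Cons[of w] Cons[of "b p"] show ?case
    by auto
qed simp

lemma finite_supp_elim:
  assumes "\<And>m. finite (supp (b m))" "finite (supp w)"
  shows "finite (supp (elim b x ps w))"
  by (rule finite_subset[OF supp_elim]) (use assms in auto)

lemma elim_outside:
  "(\<And>p. p \<in> set ps \<Longrightarrow> b p c = 0) \<Longrightarrow> elim b x ps w c = pivot_prod b x ps * w c"
  by (induction ps arbitrary: w) (auto simp: algebra_simps)

text \<open>For the row just eliminated the two products cancel; for earlier rows both row values
  vanish by induction.\<close>

lemma row_eval_elim:
  assumes "\<And>m. finite (supp (b m))" "finite (supp w)" "j < length ps"
  shows "row_eval x j (elim b x ps w) = 0"
  using assms(2,3)
proof (induction ps arbitrary: w)
  case (Cons p ps)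
  have "row_eval x j (elim b x (p # ps) w)
      = row_eval x (length ps) (elim b x ps (b p)) * row_eval x j (elim b x ps w)
        - row_eval x (length ps) (elim b x ps w) * row_eval x j (elim b x ps (b p))"
    by (simp add: row_eval_diff finite_supp_elim assms(1) Cons.prems)
  also have "\<dots> = 0"
  proof (cases "j = length ps")
    case False
    then show ?thesis
      using Cons assms(1) by (simp add: less_Suc_eq)
  qed simp
  finally show ?case .
qed simp

section \<open>Dependence of the elimination on the matrix\<close>

lemma row_eval_cong:
  assumes "\<And>c. c \<in> supp v \<Longrightarrow> x (prod_encode (i, c)) = y (prod_encode (i, c))"
  shows "row_eval x i v = row_eval y i v"
  unfolding row_eval_def using assms by (intro sum.cong) auto

text \<open>Elimination reads only rows below \<open>length ps\<close>, in columns met by the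
  vectors involved. Hence an entry of the next row can be varied freely.\<close>

lemma elim_cong:
  assumes "\<And>j c. \<lbrakk>j < length ps; c \<in> supp w \<union> (\<Union>p\<in>set ps. supp (b p))\<rbrakk>
    \<Longrightarrow> x (prod_encode (j, c)) = y (prod_encode (j, c))"
  shows "elim b x ps w = elim b y ps w"
  using assms
proof (induction ps arbitrary: w)
  case (Cons p ps)
  have 1: "elim b x ps w = elim b y ps w"
    by (rule Cons.IH, rule Cons.prems) auto
  have 2: "elim b x ps (b p) = elim b y ps (b p)"
    by (rule Cons.IH, rule Cons.prems) auto
  have "row_eval x (length ps) v = row_eval y (length ps) v"
    if "supp v \<subseteq> supp w \<union> (\<Union>p\<in>set (p # ps). supp (b p))" for v
    by (rule row_eval_cong, rule Cons.prems) (use that in auto)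
  moreover have "supp (elim b y ps w) \<subseteq> supp w \<union> (\<Union>p\<in>set (p # ps). supp (b p))"
    "supp (elim b y ps (b p)) \<subseteq> supp w \<union> (\<Union>p\<in>set (p # ps). supp (b p))"
    using supp_elim[of b y ps w] supp_elim[of b y ps "b p"] by auto
  ultimately show ?case
    by (simp add: 1 2)
qed simp

lemma poly_fun_row_eval:
  assumes "finite D" "\<And>x. supp (V x) \<subseteq> D" "\<And>c. (\<lambda>x. V x c) \<in> poly_fun"
  shows "(\<lambda>x. row_eval x i (V x)) \<in> poly_fun"
proof -
  have "(\<lambda>x. \<Sum>c\<in>D. V x c * x (prod_encode (i, c))) \<in> poly_fun"
    by (intro poly_fun_sum poly_fun_mult assms poly_fun_var)
  then show ?thesis
    using row_eval_eq_sum[OF assms(1,2)] by simp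
qed

text \<open>Because no division occurs, the result stays polynomial in the matrix, so genericity
  applies to the pivots.\<close>

lemma poly_fun_elim:
  assumes "\<And>m. finite (supp (b m))" "finite (supp w)"
  shows "(\<lambda>x. elim b x ps w c) \<in> poly_fun"
  using assms(2)
proof (induction ps arbitrary: w c)
  case Nil
  show ?case
    by (simp add: poly_fun_const)
next
  case (Cons p ps)
  have "(\<lambda>x. row_eval x (length ps) (elim b x ps u)) \<in> poly_fun" if "finite (supp u)" for u
    by (rule poly_fun_row_eval[OF _ supp_elim]) (use Cons.IH that assms(1) in auto)
  then show ?case
    using Cons assms(1) by (auto intro!: poly_fun_diff poly_fun_mult)
qed

text \<open>Among the values \<open>\<phi> j c\<close> relevant for the next pivot, the largest one is \<open>\<phi> i c\<close> for a
  single \<open>c\<close> in the support of the new vector \<open>b m\<close>. The prospective pivot is an affine function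
  of \<open>\<mu> (\<phi> i c)\<close> with nonzero slope, hence nonzero by genericity.\<close>

lemma independence_from_growth:
  fixes b :: "nat \<Rightarrow> nat \<Rightarrow> 'a::field" and \<mu> :: "nat \<Rightarrow> 'a"
  assumes generic: "\<And>p v. p \<in> poly_fun \<Longrightarrow> \<exists>N. \<forall>n\<ge>N. \<forall>\<tau>. (\<forall>w. w \<noteq> v \<longrightarrow> \<tau> w < n)
      \<longrightarrow> finite {z. p ((\<mu> \<circ> \<tau>)(v := z)) = 0} \<longrightarrow> p ((\<mu> \<circ> \<tau>)(v := \<mu> n)) \<noteq> 0"
    and fin: "\<And>m. finite (supp (b m))"
    and nz: "\<And>m. supp (b m) \<noteq> {}"
    and ge: "\<And>m c. c \<in> supp (b m) \<Longrightarrow> m \<le> c"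
  defines "C \<equiv> \<Union>m. supp (b m)"
  shows "\<exists>g. \<forall>k (\<phi> :: nat \<Rightarrow> nat \<Rightarrow> nat) a. (\<forall>i<k. inj_on (\<phi> i) C \<and> (\<forall>n. \<exists>m\<ge>n. \<forall>c\<in>C. m \<le> c
        \<longrightarrow> g m \<le> \<phi> i c \<and> (\<forall>j<i. \<forall>c'\<in>C. c' < g m \<longrightarrow> \<phi> j c' < \<phi> i c)))
      \<longrightarrow> (\<forall>m. (\<Sum>i<k. a i * (\<Sum>c\<in>supp (b m). b m c * \<mu> (\<phi> i c))) = 0)
      \<longrightarrow> (\<forall>i<k. a i = 0)"
proof -
  have "\<forall>p v. \<exists>N. p \<in> poly_fun \<longrightarrow> (\<forall>n\<ge>N. \<forall>\<tau>. (\<forall>w. w \<noteq> v \<longrightarrow> \<tau> w < n)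
      \<longrightarrow> finite {z. p ((\<mu> \<circ> \<tau>)(v := z)) = 0} \<longrightarrow> p ((\<mu> \<circ> \<tau>)(v := \<mu> n)) \<noteq> 0)"
    using generic by blast
  then obtain N where N: "\<And>p v n \<tau>. \<lbrakk>p \<in> poly_fun; N p v \<le> n; \<And>w. w \<noteq> v \<Longrightarrow> \<tau> w < n;
      finite {z. p ((\<mu> \<circ> \<tau>)(v := z)) = 0}\<rbrakk> \<Longrightarrow> p ((\<mu> \<circ> \<tau>)(v := \<mu> n)) \<noteq> 0"
    by metis
  define P where "P ps m x = row_eval x (length ps) (elim b x ps (b m))" for ps m x
  have P_poly: "P ps m \<in> poly_fun" for ps m
    unfolding P_def
    by (rule poly_fun_row_eval[OF _ supp_elim]) (use fin poly_fun_elim[of b] in auto)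
  \<comment> \<open>\<open>g m\<close> is to bound the columns of all vectors up to \<open>m\<close>
    and the genericity threshold of every pivot that \<open>b m\<close> can produce. Limiting
    entries and length of the pivot lists by \<open>m\<close> leaves finitely many.\<close>
  define G where "G m = insert m ((\<Union>l\<le>m. Suc ` supp (b l))
    \<union> (\<Union>ps\<in>{ps. set ps \<subseteq> {..m} \<and> length ps \<le> m}.
        \<Union>c\<in>supp (b m). {N (P ps m) (prod_encode (length ps, c))}))" for m
  have "finite (G m)" for m
    unfolding G_def using fin finite_lists_length_le[of "{..m}" m] by auto
  then have "\<forall>m. \<exists>g. \<forall>t\<in>G m. t \<le> g"
    using finite_nat_set_iff_bounded_le by blast
  then obtain g where g: "\<And>m. \<forall>t\<in>G m. t \<le> g m"
    by metis
  have g_ge: "m \<le> g m" for m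
    using g[of m] by (auto simp: G_def)
  have g_supp: "c < g m" if "l \<le> m" "c \<in> supp (b l)" for l m c
  proof -
    have "Suc c \<in> G m"
      unfolding G_def using that by auto
    then show ?thesis
      using g[of m] by (auto simp: Suc_le_eq)
  qed
  have g_N: "N (P ps m) (prod_encode (length ps, c)) \<le> g m"
    if "set ps \<subseteq> {..m}" "length ps \<le> m" "c \<in> supp (b m)" for ps m c
  proof -
    have "N (P ps m) (prod_encode (length ps, c)) \<in> G m"
      unfolding G_def using that by auto
    then show ?thesis
      using g[of m] by auto
  qed
  show ?thesis
  proof (intro exI[of _ g] allI impI)
    fix k i and \<phi> :: "nat \<Rightarrow> nat \<Rightarrow> nat" and a
    assume \<phi>: "\<forall>i<k. inj_on (\<phi> i) C \<and> (\<forall>n. \<exists>m\<ge>n. \<forall>c\<in>C. m \<le> c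
        \<longrightarrow> g m \<le> \<phi> i c \<and> (\<forall>j<i. \<forall>c'\<in>C. c' < g m \<longrightarrow> \<phi> j c' < \<phi> i c))"
      and zero: "\<forall>m. (\<Sum>i<k. a i * (\<Sum>c\<in>supp (b m). b m c * \<mu> (\<phi> i c))) = 0"
      and "i < k"
    define x where "x v = \<mu> (case_prod \<phi> (prod_decode v))" for v
    have pivots: "\<exists>ps. length ps = n \<and> pivot_prod b x ps \<noteq> 0" if "n \<le> k" for n
      using that
    proof (induction n)
      case 0
      show ?case
        by simp
    next
      case (Suc n)
      then obtain ps where ps: "length ps = n" "pivot_prod b x ps \<noteq> 0"
        by auto
      define Dps where "Dps = (\<Union>p\<in>set ps. supp (b p))"
      have finD: "finite Dps"
        using fin by (simp add: Dps_def)
      \<comment> \<open>For \<open>m\<close> above \<open>B\<close>, the support of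
        \<open>b m\<close> lies beyond all old columns, and in row \<open>n\<close> the old columns
        have smaller values than the new ones.\<close>
      obtain B where B: "\<forall>t \<in> insert n (set ps) \<union> Dps \<union> \<phi> n ` Dps. t < B"
        using finD finite_nat_set_iff_bounded[of "insert n (set ps) \<union> Dps \<union> \<phi> n ` Dps"]
        by blast
      obtain m where m: "B \<le> m" and m_large: "\<And>c. \<lbrakk>c \<in> C; m \<le> c\<rbrakk> \<Longrightarrow> g m \<le> \<phi> n c"
        and m_dom: "\<And>c j c'. \<lbrakk>c \<in> C; m \<le> c; j < n; c' \<in> C; c' < g m\<rbrakk> \<Longrightarrow> \<phi> j c' < \<phi> n c"
        using \<phi> Suc.prems by (metis Suc_le_lessD)
      have inj: "inj_on (\<phi> n) C"
        using \<phi> Suc.prems by auto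
      define D where "D = supp (b m) \<union> Dps"
      have "Max (\<phi> n ` supp (b m)) \<in> \<phi> n ` supp (b m)"
        using fin nz by (intro Max_in) auto
      then obtain c0 where c0: "c0 \<in> supp (b m)" "\<phi> n c0 = Max (\<phi> n ` supp (b m))"
        by auto
      then have c0': "c0 \<in> C" "m \<le> c0"
        using ge by (auto simp: C_def)
      \<comment> \<open>Row \<open>n\<close> is settled by \<open>B\<close> on old columns and by
        maximality and injectivity on new ones; earlier rows are dominated because all columns of
        \<open>D\<close> lie below \<open>g m\<close>.\<close>
      have less: "\<phi> j c < \<phi> n c0" if "j \<le> n" "c \<in> D" "(j, c) \<noteq> (n, c0)" for j c
      proof (cases "j = n")
        case True
        show ?thesis
        proof (cases "c \<in> Dps")
          case True
          then have "\<phi> n c < B"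
            using B by blast
          also note m
          also have "m \<le> \<phi> n c0"
            using m_large[OF c0'] g_ge[of m] by simp
          finally show ?thesis
            by (simp add: \<open>j = n\<close>)
        next
          case False
          then have c: "c \<in> supp (b m)"
            using that by (auto simp: D_def)
          then have "\<phi> n c \<le> \<phi> n c0"
            using fin by (auto simp: c0)
          moreover have "\<phi> n c \<noteq> \<phi> n c0"
            using inj c c0'(1) that True by (auto simp: C_def dest: inj_onD)
          ultimately show ?thesis
            by (simp add: True)
        qed
      next
        case False
        have "\<exists>l\<le>m. c \<in> supp (b l)"
          using that B m by (auto simp: D_def Dps_def intro: less_imp_le order.strict_trans2)
        then have "c \<in> C" "c < g m"
          using g_supp by (auto simp: C_def)
        with False that show ?thesis
          using m_dom[OF c0'] by auto
      qed
      \<comment> \<open>The default 0 keeps the irrelevant variables below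
        \<open>\<phi> n c0\<close>, as genericity demands of every variable but
        \<open>v0\<close>.\<close>
      define \<tau> where "\<tau> v = (case prod_decode v of (j, c) \<Rightarrow> if j \<le> n \<and> c \<in> D then \<phi> j c else 0)"
        for v
      define v0 where "v0 = prod_encode (n, c0)"
      have \<tau>_v0: "\<tau> v0 = \<phi> n c0"
        using c0 by (simp add: \<tau>_def v0_def D_def)
      have \<tau>_less: "\<tau> w < \<phi> n c0" if "w \<noteq> v0" for w
      proof -
        obtain j c where w: "w = prod_encode (j, c)"
          by (metis prod_decode_inverse surj_pair)
        show ?thesis
        proof (cases "j \<le> n \<and> c \<in> D")
          case True
          then show ?thesis
            using less[of j c] that by (auto simp: w v0_def \<tau>_def)
        next
          case False
          have "n < \<phi> n c0"
            using m_large[OF c0'] g_ge[of m] B m by auto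
          then show ?thesis
            using False by (auto simp: w \<tau>_def)
        qed
      qed
      have P_cong: "P ps m y = P ps m z"
        if "\<And>j c. \<lbrakk>j \<le> n; c \<in> D\<rbrakk> \<Longrightarrow> y (prod_encode (j, c)) = z (prod_encode (j, c))" for y z
      proof -
        have "elim b y ps (b m) = elim b z ps (b m)"
          using that by (intro elim_cong) (auto simp: D_def Dps_def ps)
        moreover have "row_eval y n (elim b z ps (b m)) = row_eval z n (elim b z ps (b m))"
          by (rule row_eval_cong, rule that)
            (use supp_elim[of b z ps "b m"] in \<open>auto simp: D_def Dps_def\<close>)
        ultimately show ?thesis
          by (simp add: P_def ps)
      qed
      define V where "V = elim b (\<mu> \<circ> \<tau>) ps (b m)"
      have V_supp: "supp V \<subseteq> D"
        unfolding V_def D_def Dps_def by (rule supp_elim)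
      have "c0 \<notin> Dps"
        using B m c0'(2) by (meson UnCI leD order.strict_trans2)
      then have c0_outside: "b p c0 = 0" if "p \<in> set ps" for p
        using that by (auto simp: Dps_def not_in_supp)
      have V_x: "V = elim b x ps (b m)"
        unfolding V_def
        by (rule elim_cong) (auto simp: x_def \<tau>_def D_def Dps_def ps)
      \<comment> \<open>The slope: no old pivot vector meets column \<open>c0\<close>, so
        elimination only rescales this coordinate.\<close>
      have "V c0 = pivot_prod b x ps * b m c0"
        unfolding V_x by (rule elim_outside) (rule c0_outside)
      then have V_c0: "V c0 \<noteq> 0"
        using ps c0 by (simp add: supp_def)
      \<comment> \<open>The variable \<open>v0\<close> belongs to row \<open>n\<close>, whereas
        elimination by \<open>ps\<close> reads only rows below \<open>n\<close>; so \<open>V\<close>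
        does not change with \<open>z\<close>.\<close>
      have P_affine: "P ps m ((\<mu> \<circ> \<tau>)(v0 := z))
        = V c0 * z + (\<Sum>c\<in>D - {c0}. V c * (\<mu> \<circ> \<tau>) (prod_encode (n, c)))" for z
      proof -
        have "elim b ((\<mu> \<circ> \<tau>)(v0 := z)) ps (b m) = V"
          unfolding V_def by (rule elim_cong) (auto simp: ps v0_def)
        then have "P ps m ((\<mu> \<circ> \<tau>)(v0 := z))
            = (\<Sum>c\<in>D. V c * ((\<mu> \<circ> \<tau>)(v0 := z)) (prod_encode (n, c)))"
          unfolding P_def ps using row_eval_eq_sum[OF _ V_supp] fin finD by (simp add: D_def)
        also have "\<dots> = V c0 * z + (\<Sum>c\<in>D - {c0}. V c * ((\<mu> \<circ> \<tau>)(v0 := z)) (prod_encode (n, c)))"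
          using fin finD c0 by (subst sum.remove[of _ c0]) (auto simp: D_def v0_def)
        also have "(\<Sum>c\<in>D - {c0}. V c * ((\<mu> \<circ> \<tau>)(v0 := z)) (prod_encode (n, c)))
            = (\<Sum>c\<in>D - {c0}. V c * (\<mu> \<circ> \<tau>) (prod_encode (n, c)))"
          by (intro sum.cong) (auto simp: v0_def)
        finally show ?thesis .
      qed
      have "P ps m ((\<mu> \<circ> \<tau>)(v0 := \<mu> (\<phi> n c0))) \<noteq> 0"
      proof (rule N[OF P_poly])
        show "N (P ps m) v0 \<le> \<phi> n c0"
        proof -
          have "t \<le> m" if "t \<in> insert n (set ps)" for t
          proof -
            have "t < B"
              using B that by blast
            with m show ?thesis
              by simp
          qed
          then have "set ps \<subseteq> {..m}" "length ps \<le> m"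
            using ps(1) by auto
          then show ?thesis
            using g_N[OF _ _ c0(1)] m_large[OF c0'] by (fastforce simp: v0_def ps(1))
        qed
        show "finite {z. P ps m ((\<mu> \<circ> \<tau>)(v0 := z)) = 0}"
        proof (rule finite_subset)
          show "{z. P ps m ((\<mu> \<circ> \<tau>)(v0 := z)) = 0}
              \<subseteq> {- (\<Sum>c\<in>D - {c0}. V c * (\<mu> \<circ> \<tau>) (prod_encode (n, c))) / V c0}"
            unfolding P_affine using V_c0 by (auto simp: field_simps add_eq_0_iff)
        qed simp
      qed (use \<tau>_less in auto)
      also have "P ps m ((\<mu> \<circ> \<tau>)(v0 := \<mu> (\<phi> n c0))) = P ps m x"
        by (rule P_cong) (auto simp: x_def \<tau>_def v0_def)
      finally show ?case
        using ps by (intro exI[of _ "m # ps"]) (simp add: P_def)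
    qed
    \<comment> \<open>The assumed relation among the rows. It vanishes on each \<open>b m\<close>,
      hence on all results of elimination, which are combinations of these.\<close>
    define L where "L v = (\<Sum>i<k. a i * row_eval x i v)" for v
    have L_b: "L (b m) = 0" for m
      using zero by (simp add: L_def row_eval_def x_def)
    have L_elim: "L (elim b x ps (b m)) = 0" for ps m
    proof (induction ps arbitrary: m)
      case (Cons p ps)
      have "L (\<lambda>c. s * v c - t * w c) = s * L v - t * L w"
        if "finite (supp v)" "finite (supp w)" for s t v w
        unfolding L_def using that
        by (simp add: row_eval_diff sum_distrib_left algebra_simps sum_subtractf)
      then show ?case
        using Cons by (simp add: finite_supp_elim fin)
    qed (simp add: L_b)
    show "a i = 0"
    proof (rule ccontr)
      assume "a i \<noteq> 0"
      \<comment> \<open>At the last nonzero coefficient, eliminating all earlier rows leaves one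
        term of the relation: that coefficient times a nonzero pivot.\<close>
      define I where "I = {i. i < k \<and> a i \<noteq> 0}"
      have "finite I" "I \<noteq> {}"
        using \<open>i < k\<close> \<open>a i \<noteq> 0\<close> by (auto simp: I_def)
      then have n: "Max I \<in> I" "\<And>j. j \<in> I \<Longrightarrow> j \<le> Max I"
        by auto
      then obtain qs where qs: "length qs = Suc (Max I)" "pivot_prod b x qs \<noteq> 0"
        using pivots[of "Suc (Max I)"] by (auto simp: I_def)
      then obtain p ps where "qs = p # ps"
        by (cases qs) auto
      with qs have ps: "length ps = Max I" "row_eval x (Max I) (elim b x ps (b p)) \<noteq> 0"
        by auto
      have "L (elim b x ps (b p)) = a (Max I) * row_eval x (Max I) (elim b x ps (b p))"
      proof -
        have "a j * row_eval x j (elim b x ps (b p)) = 0" if "j < k" "j \<noteq> Max I" for j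
        proof (cases "j < Max I")
          case True
          then show ?thesis
            using row_eval_elim[of b "b p" j ps x] fin ps by simp
        next
          case False
          then have "j \<notin> I"
            using n(2)[of j] that by auto
          with that show ?thesis
            by (simp add: I_def)
        qed
        then have "(\<Sum>j\<in>{..<k} - {Max I}. a j * row_eval x j (elim b x ps (b p))) = 0"
          by (intro sum.neutral) auto
        moreover have "Max I < k"
          using n(1) unfolding I_def by blast
        ultimately show ?thesis
          unfolding L_def by (subst sum.remove[of _ "Max I"]) auto
      qed
      with L_elim[of ps p] ps n(1) show False
        by (simp add: I_def)
    qed
  qed
qed

section \<open>Families indexed by an order of type \<open>\<omega>\<^sub>1\<close>\<close>

text \<open>Diagonalization: \<open>F c\<close> exceeds the values at \<open>c\<close> of the
  functions enumerated up to the place of \<open>c\<close>, so a given \<open>G\<close> escapes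
  domination only at places before its own. The first component of the pair gives
  injectivity.\<close>

lemma countable_dominate:
  fixes C :: "'i set" and \<G> :: "('i \<Rightarrow> nat) set"
  assumes "countable C" "countable \<G>"
  shows "\<exists>F. inj_on F C \<and> (\<forall>G\<in>\<G>. finite {c \<in> C. F c \<le> G c})"
proof -
  define e where "e = to_nat_on C"
  define F where "F c = prod_encode (e c, Suc (\<Sum>i\<le>e c. from_nat_into \<G> i c))" for c
  have e: "inj_on e C"
    unfolding e_def by (rule inj_on_to_nat_on[OF assms(1)])
  then have "inj_on F C"
    by (auto simp: F_def inj_on_def)
  moreover have "finite {c \<in> C. F c \<le> G c}" if G: "G \<in> \<G>" for G
  proof -
    obtain n where n: "G = from_nat_into \<G> n"
      using from_nat_into_surj[OF assms(2) G] by metis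
    have "e c < n" if "F c \<le> G c" for c
    proof (rule ccontr)
      assume "\<not> e c < n"
      then have "G c \<le> (\<Sum>i\<le>e c. from_nat_into \<G> i c)"
        unfolding n by (intro member_le_sum) auto
      also have "\<dots> < F c"
        unfolding F_def using le_prod_encode_2 Suc_le_eq by blast
      finally show False
        using that by simp
    qed
    then have "{c \<in> C. F c \<le> G c} \<subseteq> e -` {..<n} \<inter> C"
      by auto
    then show ?thesis
      using finite_vimage_IntI[OF _ e, of "{..<n}"] finite_subset by blast
  qed
  ultimately show ?thesis
    by blast
qed

locale omega1_order =
  fixes W :: "'i set" and less :: "'i \<Rightarrow> 'i \<Rightarrow> bool" (infix \<open>\<prec>\<close> 50)
  assumes wf_less: "wf {(a, b). a \<prec> b}"
    and less_trans: "\<lbrakk>a \<prec> b; b \<prec> c\<rbrakk> \<Longrightarrow> a \<prec> c"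
    and less_total: "\<lbrakk>a \<in> W; b \<in> W; a \<noteq> b\<rbrakk> \<Longrightarrow> a \<prec> b \<or> b \<prec> a"
    and countable_less: "a \<in> W \<Longrightarrow> countable {b \<in> W. b \<prec> a}"
    and uncountable_W: "uncountable W"
begin

definition below :: "'i \<Rightarrow> 'i set"
  where "below a = {b \<in> W. b \<prec> a}"

lemma below_mono: "b \<in> below a \<Longrightarrow> below b \<subseteq> below a"
  by (auto simp: below_def intro: less_trans)

lemma countable_below: "a \<in> W \<Longrightarrow> countable (below a)"
  by (simp add: below_def countable_less)

lemma less_asym: "a \<prec> b \<Longrightarrow> \<not> b \<prec> a"
  using wf_less by (metis CollectI case_prodI wf_asym)

lemma below_of_not_below: "\<lbrakk>a \<in> W; d \<in> W; a \<notin> below d; b \<in> below d\<rbrakk> \<Longrightarrow> b \<in> below a"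
  using less_total[of a d] less_trans by (auto simp: below_def)

text \<open>Uncountable cofinality: otherwise \<open>W\<close> would be covered by \<open>A\<close>
  and countably many countable initial segments.\<close>

lemma countable_subset_below:
  assumes "countable A" "A \<subseteq> W"
  shows "\<exists>d\<in>W. A \<subseteq> below d"
proof (rule ccontr)
  assume "\<not> ?thesis"
  then have "\<forall>d\<in>W. \<exists>a\<in>A. a \<notin> below d"
    by blast
  then have "W \<subseteq> A \<union> (\<Union>a\<in>A. below a)"
    using less_total assms(2) by (fastforce simp: below_def)
  moreover have "countable (A \<union> (\<Union>a\<in>A. below a))"
    using assms countable_below by auto
  ultimately show False
    using uncountable_W countable_subset by blast
qed

lemma finite_sorted_list:
  assumes "finite A" "A \<subseteq> W"
  shows "\<exists>xs. set xs = A \<and> sorted_wrt (\<prec>) xs"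
  using assms
proof (induction A rule: finite_induct)
  case empty
  show ?case
    by (intro exI[of _ "[]"]) simp
next
  case (insert a A)
  then obtain xs where xs: "set xs = A" "sorted_wrt (\<prec>) xs"
    by auto
  have "set (filter (\<lambda>b. b \<prec> a) xs @ a # filter (\<lambda>b. a \<prec> b) xs) = insert a A"
    using insert less_total xs(1) by auto
  moreover have "sorted_wrt (\<prec>) (filter (\<lambda>b. b \<prec> a) xs @ a # filter (\<lambda>b. a \<prec> b) xs)"
    using xs(2) by (auto simp: sorted_wrt_append sorted_wrt_filter intro: less_trans)
  ultimately show ?case
    by blast
qed

text \<open>\<open>f a\<close> eventually exceeds all members of the family with index up to
  \<open>a\<close>, so a member escaping \<open>g\<close> infinitely often passes this on to every
  later \<open>f a\<close>. Partial sums make the functions monotone without decreasing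
  them.\<close>

lemma monotone_unbounded_family:
  assumes k: "bij_betw k W \<F>" and \<F>: "unbounded_family \<F>"
  shows "\<exists>h :: 'i \<Rightarrow> nat \<Rightarrow> nat. (\<forall>a\<in>W. mono (h a))
    \<and> (\<forall>g. \<exists>d\<in>W. \<forall>a\<in>W. a \<notin> below d \<longrightarrow> infinite {m. g m < h a m})"
proof -
  have "\<forall>a. \<exists>f :: nat \<Rightarrow> nat. a \<in> W \<longrightarrow> (\<forall>b\<in>insert a (below a). finite {m. f m \<le> k b m})"
  proof
    fix a
    show "\<exists>f :: nat \<Rightarrow> nat. a \<in> W \<longrightarrow> (\<forall>b\<in>insert a (below a). finite {m. f m \<le> k b m})"
      using countable_dominate[of UNIV "k ` insert a (below a)"] countable_below[of a] by auto
  qed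
  then obtain f :: "'i \<Rightarrow> nat \<Rightarrow> nat"
    where f: "\<And>a b. \<lbrakk>a \<in> W; b \<in> insert a (below a)\<rbrakk> \<Longrightarrow> finite {m. f a m \<le> k b m}"
    by metis
  define h where "h a m = (\<Sum>i\<le>m. f a i)" for a m
  have "mono (h a)" for a
    unfolding h_def by (intro monoI sum_mono2) auto
  moreover have "\<exists>d\<in>W. \<forall>a\<in>W. a \<notin> below d \<longrightarrow> infinite {m. g m < h a m}" for g
  proof -
    \<comment> \<open>Unboundedness is applied to the successor of \<open>g\<close> to obtain a
      strict inequality.\<close>
    obtain d where d: "d \<in> W" "infinite {m. g m < k d m}"
      using \<F> k unfolding unbounded_family_def eventually_less_def bij_betw_def
      by (auto simp: not_less Suc_le_eq dest!: spec[of _ "\<lambda>m. Suc (g m)"])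
    have "infinite {m. g m < h a m}" if a: "a \<in> W" "a \<notin> below d" for a
    proof
      assume fin: "finite {m. g m < h a m}"
      have "d \<in> insert a (below a)"
        using a d(1) less_total[of a d] by (auto simp: below_def)
      with a have "finite {m. f a m \<le> k d m}"
        by (intro f)
      with fin have "finite ({m. g m < h a m} \<union> {m. f a m \<le> k d m})"
        by simp
      moreover have "{m. g m < k d m} \<subseteq> {m. g m < h a m} \<union> {m. f a m \<le> k d m}"
      proof
        fix m
        have "f a m \<le> h a m"
          unfolding h_def by (rule member_le_sum) auto
        then show "m \<in> {m. g m < h a m} \<union> {m. f a m \<le> k d m}" if "m \<in> {m. g m < k d m}"
          using that by auto
      qed
      ultimately show False
        using d(2) finite_subset by blast
    qed
    with d(1) show ?thesis
      by blast
  qed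
  ultimately show ?thesis
    by blast
qed

text \<open>Each \<open>d\<close> enumerates \<open>below d\<close> by \<open>F d\<close>. For almost all \<open>b\<close> in this enumeration, the value
  \<open>F a b\<close> exceeds all values \<open>F c b'\<close> with \<open>b'\<close> among the first \<open>h a (F d b)\<close> elements.\<close>

lemma dominating_injections:
  fixes h :: "'i \<Rightarrow> nat \<Rightarrow> nat"
  shows "\<exists>F :: 'i \<Rightarrow> 'i \<Rightarrow> nat. \<forall>a. a \<in> W \<longrightarrow> inj_on (F a) (below a)
    \<and> (\<forall>d\<in>below a. \<forall>c\<in>below a. finite {b \<in> below d.
        F a b \<le> h a (F d b) + (\<Sum>b'\<in>{b' \<in> below d. F d b' < h a (F d b)}. F c b')})"
\<comment> \<open>The rule asks that the condition at \<open>a\<close> depend only on earlier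
  values; it does, as \<open>c\<close> and \<open>d\<close> range over
  \<open>below a\<close>.\<close>
proof (rule dependent_wf_choice[OF wf_less])
  fix f g :: "'i \<Rightarrow> 'i \<Rightarrow> nat" and a and r :: "'i \<Rightarrow> nat"
  assume "\<And>z. (z, a) \<in> {(a, b). a \<prec> b} \<Longrightarrow> f z = g z"
  then have fg: "f z = g z" if "z \<in> below a" for z
    using that by (simp add: below_def)
  show "(a \<in> W \<longrightarrow> inj_on r (below a) \<and> (\<forall>d\<in>below a. \<forall>c\<in>below a. finite {b \<in> below d.
        r b \<le> h a (f d b) + (\<Sum>b'\<in>{b' \<in> below d. f d b' < h a (f d b)}. f c b')}))
    = (a \<in> W \<longrightarrow> inj_on r (below a) \<and> (\<forall>d\<in>below a. \<forall>c\<in>below a. finite {b \<in> below d.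
        r b \<le> h a (g d b) + (\<Sum>b'\<in>{b' \<in> below d. g d b' < h a (g d b)}. g c b')}))"
    using fg by simp
next
  fix a and f :: "'i \<Rightarrow> 'i \<Rightarrow> nat"
  define H where "H d c b = h a (f d b) + (\<Sum>b'\<in>{b' \<in> below d. f d b' < h a (f d b)}. f c b')"
    for d c b
  have "\<exists>r. inj_on r (below a) \<and> (\<forall>G\<in>case_prod H ` (below a \<times> below a).
      finite {b \<in> below a. r b \<le> G b})" if "a \<in> W"
    using countable_below[OF that] by (intro countable_dominate) auto
  then obtain r where r: "a \<in> W \<longrightarrow> inj_on r (below a)"
    "\<And>d c. \<lbrakk>a \<in> W; d \<in> below a; c \<in> below a\<rbrakk> \<Longrightarrow> finite {b \<in> below a. r b \<le> H d c b}"
    by fastforce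
  have "finite {b \<in> below d. r b \<le> H d c b}" if "a \<in> W" "d \<in> below a" "c \<in> below a" for d c
    using below_mono[OF that(2)] by (intro finite_subset[OF _ r(2)[OF that]]) auto
  with r(1) show "\<exists>r. a \<in> W \<longrightarrow> inj_on r (below a) \<and> (\<forall>d\<in>below a. \<forall>c\<in>below a. finite {b \<in> below d.
        r b \<le> h a (f d b) + (\<Sum>b'\<in>{b' \<in> below d. f d b' < h a (f d b)}. f c b')})"
    unfolding H_def by blast
qed

end

text \<open>Proper initial segments of a cardinal order have smaller cardinality, and below the
  successor of \<open>natLeq\<close> this means countable.\<close>

lemma omega1_order_aleph1: "omega1_order (Field aleph1) (\<lambda>a b. (a, b) \<in> aleph1 - Id)"
proof -
  have card: "Card_order aleph1"
    unfolding aleph1_def by (rule cardSuc_Card_order[OF natLeq_Card_order])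
  then have wo: "Well_order aleph1"
    by (simp add: card_order_on_def)
  have less_iff: "\<And>a b. (a, b) \<in> aleph1 - Id \<longleftrightarrow> a \<in> underS aleph1 b"
    by (auto simp: underS_def)
  show ?thesis
  proof
    have "{(a, b). (a, b) \<in> aleph1 - Id} = aleph1 - Id"
      by auto
    then show "wf {(a, b). (a, b) \<in> aleph1 - Id}"
      using wo by (simp add: well_order_on_def)
    have "trans (aleph1 - Id)"
      using wo trans_diff_Id
      unfolding well_order_on_def linear_order_on_def partial_order_on_def preorder_on_def by blast
    then show "(a, c) \<in> aleph1 - Id" if "(a, b) \<in> aleph1 - Id" "(b, c) \<in> aleph1 - Id" for a b c
      using that by (blast dest: transD)
    show "(a, b) \<in> aleph1 - Id \<or> (b, a) \<in> aleph1 - Id"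
      if "a \<in> Field aleph1" "b \<in> Field aleph1" "a \<noteq> b" for a b
      using wo that unfolding well_order_on_def linear_order_on_def total_on_def by auto
    show "countable {b \<in> Field aleph1. (b, a) \<in> aleph1 - Id}" if "a \<in> Field aleph1" for a
    proof -
      have "|underS aleph1 a| <o cardSuc natLeq"
        using card_of_underS[OF card that] by (simp add: aleph1_def)
      then have "countable (underS aleph1 a)"
        unfolding countable_card_le_natLeq
        using cardSuc_ordLeq_ordLess[OF natLeq_Card_order card_of_Card_order] by blast
      then show ?thesis
        unfolding less_iff by (rule countable_subset[rotated]) auto
    qed
    show "uncountable (Field aleph1)"
    proof
      assume "countable (Field aleph1)"
      then have "|Field aleph1| \<le>o natLeq"
        by (simp add: countable_card_le_natLeq)
      with card_of_Field_ordIso[OF card] have "aleph1 \<le>o natLeq"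
        using ordIso_ordLeq_trans ordIso_symmetric by blast
      then show False
        using cardSuc_greater[OF natLeq_Card_order] not_ordLess_ordLeq
        unfolding aleph1_def by blast
    qed
  qed
qed

section \<open>The space\<close>

locale omega1_form = omega1_order W less
  for W :: "'i set" and less (infix \<open>\<prec>\<close> 50) +
  fixes \<mu> :: "nat \<Rightarrow> 'a::field" and h :: "'i \<Rightarrow> nat \<Rightarrow> nat" and F :: "'i \<Rightarrow> 'i \<Rightarrow> nat"
  assumes generic: "p \<in> poly_fun \<Longrightarrow> \<exists>N. \<forall>n\<ge>N. \<forall>\<tau>. (\<forall>w. w \<noteq> v \<longrightarrow> \<tau> w < n)
      \<longrightarrow> finite {z. p ((\<mu> \<circ> \<tau>)(v := z)) = 0} \<longrightarrow> p ((\<mu> \<circ> \<tau>)(v := \<mu> n)) \<noteq> 0"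
    and mono_h: "a \<in> W \<Longrightarrow> mono (h a)"
    and unbounded_h: "\<exists>d\<in>W. \<forall>a\<in>W. a \<notin> below d \<longrightarrow> infinite {m. g m < h a m}"
    and inj_F: "a \<in> W \<Longrightarrow> inj_on (F a) (below a)"
    and F_dominates: "\<lbrakk>a \<in> W; d \<in> below a; c \<in> below a\<rbrakk> \<Longrightarrow> finite {b \<in> below d.
        F a b \<le> h a (F d b) + (\<Sum>b'\<in>{b' \<in> below d. F d b' < h a (F d b)}. F c b')}"
begin

definition gram :: "'i \<Rightarrow> 'i \<Rightarrow> 'a"
  where "gram a b = (if b \<prec> a then \<mu> (F a b) else if a \<prec> b then \<mu> (F b a) else 0)"

definition form :: "('i \<Rightarrow> 'a) \<Rightarrow> ('i \<Rightarrow> 'a) \<Rightarrow> 'a"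
  where "form x y = (\<Sum>a\<in>supp x. \<Sum>b\<in>supp y. x a * y b * gram a b)"

definition E :: "('i \<Rightarrow> 'a) set"
  where "E = fs.span (unit_fun ` W)"

lemma E_eq: "E = {v. finite (supp v) \<and> supp v \<subseteq> W}"
  unfolding E_def by (rule span_unit_fun)

lemma gram_sym: "gram a b = gram b a"
  using less_asym by (auto simp: gram_def)

lemma form_eq_sum:
  assumes "finite A" "finite B" "supp x \<subseteq> A" "supp y \<subseteq> B"
  shows "form x y = (\<Sum>a\<in>A. \<Sum>b\<in>B. x a * y b * gram a b)"
proof -
  have "form x y = (\<Sum>a\<in>supp x. \<Sum>b\<in>B. x a * y b * gram a b)"
    unfolding form_def using assms
    by (intro sum.cong refl sum.mono_neutral_left) (auto simp: supp_def)
  also have "\<dots> = (\<Sum>a\<in>A. \<Sum>b\<in>B. x a * y b * gram a b)"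
    using assms by (intro sum.mono_neutral_left) (auto simp: supp_def)
  finally show ?thesis .
qed

sublocale symmetric_bilinear_space fun_scale E form
proof unfold_locales
  show "fs.subspace E"
    unfolding E_def by (rule fs.subspace_span)
  show "form x y = form y x" for x y
    unfolding form_def by (subst sum.swap) (auto simp: gram_sym mult_ac)
  fix x y z :: "'i \<Rightarrow> 'a" and c
  assume "x \<in> E" "y \<in> E"
  then have fin: "finite (supp x)" "finite (supp y)"
    by (auto simp: E_eq)
  have "supp (fun_scale c x) \<subseteq> supp x"
    by (auto simp: supp_def)
  then have "form (fun_scale c x) y = (\<Sum>a\<in>supp x. \<Sum>b\<in>supp y. (c * x a) * y b * gram a b)"
    using fin by (subst form_eq_sum[of "supp x" "supp y"]) auto
  then show "form (fun_scale c x) y = c * form x y"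
    by (simp add: form_def sum_distrib_left mult.assoc)
  assume "z \<in> E"
  then have "finite (supp z)"
    by (auto simp: E_eq)
  moreover have "supp (x + y) \<subseteq> supp x \<union> supp y"
    by (auto simp: supp_def)
  ultimately show "form (x + y) z = form x z + form y z"
    using fin by (subst (1 2 3) form_eq_sum[of "supp x \<union> supp y" "supp z"])
      (auto simp: algebra_simps sum.distrib)
qed

lemma subspace_perp: "U \<subseteq> E \<Longrightarrow> fs.subspace (perp U)"
  unfolding fs.subspace_def perp_def
  using fs.subspace_0[OF subspace_E] fs.subspace_add[OF subspace_E] fs.subspace_scale[OF subspace_E]
  by (auto simp: Phi_add_left Phi_scale_left subset_iff) (simp add: form_def supp_def)

lemma small_perp:
  assumes U: "fs.subspace U" "U \<subseteq> E" and B: "fs.independent B" "infinite B" "B \<subseteq> U"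
  shows "\<exists>d\<in>W. \<forall>x\<in>perp U. supp x \<inter> below d = {} \<longrightarrow> x = 0"
proof -
  \<comment> \<open>Countably many independent vectors suffice, and their supports fit below a
    single \<open>d\<close>.\<close>
  obtain s :: "nat \<Rightarrow> 'i \<Rightarrow> 'a" where s: "inj s" "range s \<subseteq> B"
    using infinite_countable_subset[OF B(2)] by blast
  have "finite (supp (s n)) \<and> supp (s n) \<subseteq> W" for n
    using s(2) B(3) U(2) unfolding E_eq by blast
  then obtain d where d: "d \<in> W" "(\<Union>n. supp (s n)) \<subseteq> below d"
    using countable_subset_below[of "\<Union>n. supp (s n)"] by (auto intro: countable_finite)
  have "range s \<subseteq> fs.span (unit_fun ` below d)"
    using d \<open>\<And>n. finite (supp (s n)) \<and> supp (s n) \<subseteq> W\<close> unfolding span_unit_fun by blast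
  then have span_s: "fs.span (range s) \<subseteq> fs.span (unit_fun ` below d)"
    by (metis fs.span_mono fs.span_span)
  have span_U: "fs.span (range s) \<subseteq> U"
    using s(2) B(3) U(1) by (intro fs.span_minimal) auto
  have ind_s: "fs.independent (range s)"
    using B(1) s(2) by (rule fs.independent_mono)
  have fin_below: "finite {b \<in> below d. F d b < m}" for m
  proof (rule finite_subset)
    show "{b \<in> below d. F d b < m} \<subseteq> F d -` {..<m} \<inter> below d"
      by auto
  qed (intro finite_vimage_IntI inj_F d(1), simp)
  \<comment> \<open>Restriction to finitely many coordinates cannot be injective on an
    infinite-dimensional span.\<close>
  have "\<exists>v\<in>fs.span (range s). v \<noteq> 0 \<and> (\<forall>i\<in>{b \<in> below d. F d b < m}. v i = 0)" for m
  proof (rule ccontr)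
    assume "\<not> ?thesis"
    moreover have "finite (supp v)" if "v \<in> range s" for v
      using span_s fs.span_base[OF that] by (auto simp: span_unit_fun)
    ultimately have "|range s| \<le>o |{b \<in> below d. F d b < m}|"
      using ind_s by (intro independent_card_le) auto
    then have "finite (range s)"
      using fin_below card_of_ordLeq_finite by blast
    then show False
      using s(1) finite_imageD infinite_UNIV_nat by blast
  qed
  then obtain u where u: "\<And>m. u m \<in> fs.span (range s)" "\<And>m. u m \<noteq> 0"
    "\<And>m i. \<lbrakk>i \<in> below d; F d i < m\<rbrakk> \<Longrightarrow> u m i = 0"
    by (metis (no_types, lifting) mem_Collect_eq)
  have u_supp: "finite (supp (u m))" "supp (u m) \<subseteq> below d" for m
    using u(1)[of m] span_s unfolding span_unit_fun by auto
  define \<iota> where "\<iota> = inv_into (below d) (F d)"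
  have \<iota>: "\<iota> (F d b) = b" if "b \<in> below d" for b
    unfolding \<iota>_def using inj_F[OF d(1)] that by simp
  \<comment> \<open>Transport along \<open>F d\<close> to natural-number coordinates, so that
    \<open>g\<close> is fixed before any \<open>x\<close> is given.\<close>
  define b where "b m c = (if c \<in> F d ` below d then u m (\<iota> c) else 0)" for m c
  have supp_b: "supp (b m) = F d ` supp (u m)" for m
  proof (intro set_eqI iffI)
    fix c
    assume "c \<in> supp (b m)"
    then have "c \<in> F d ` below d" "u m (\<iota> c) \<noteq> 0"
      by (auto simp: b_def supp_def split: if_splits)
    then obtain e where "e \<in> below d" "c = F d e" "u m e \<noteq> 0"
      using \<iota> by auto
    then show "c \<in> F d ` supp (u m)"
      by (auto simp: supp_def)
  next
    fix c
    assume "c \<in> F d ` supp (u m)"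
    then obtain e where "e \<in> below d" "c = F d e" "u m e \<noteq> 0"
      using u_supp(2)[of m] by (auto simp: supp_def)
    then show "c \<in> supp (b m)"
      using \<iota> by (simp add: b_def supp_def)
  qed
  define C where "C = (\<Union>m. supp (b m))"
  have C: "\<iota> c \<in> below d" "F d (\<iota> c) = c" if "c \<in> C" for c
    using that u_supp(2) \<iota> by (auto simp: C_def supp_b subset_iff)
  obtain g where g: "\<forall>k (\<phi> :: nat \<Rightarrow> nat \<Rightarrow> nat) a.
      (\<forall>i<k. inj_on (\<phi> i) C \<and> (\<forall>n. \<exists>m\<ge>n. \<forall>c\<in>C. m \<le> c
        \<longrightarrow> g m \<le> \<phi> i c \<and> (\<forall>j<i. \<forall>c'\<in>C. c' < g m \<longrightarrow> \<phi> j c' < \<phi> i c)))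
      \<longrightarrow> (\<forall>m. (\<Sum>i<k. a i * (\<Sum>c\<in>supp (b m). b m c * \<mu> (\<phi> i c))) = 0)
      \<longrightarrow> (\<forall>i<k. a i = 0)"
    unfolding C_def
  proof (rule exE[OF independence_from_growth[where \<mu> = \<mu> and b = b]])
    show "finite (supp (b m))" for m
      using u_supp by (simp add: supp_b)
    show "supp (b m) \<noteq> {}" for m
      unfolding supp_b using u(2)[of m] by (auto simp: supp_def fun_eq_iff)
    show "m \<le> c" if c: "c \<in> supp (b m)" for m c
    proof -
      obtain e where "e \<in> supp (u m)" "c = F d e"
        using c unfolding supp_b by blast
      then show ?thesis
        using u(3)[of e m] u_supp(2)[of m] by (auto simp: supp_def not_less[symmetric])
    qed
  qed (rule generic, assumption, blast)
  obtain d0 where d0: "d0 \<in> W" "\<And>a. \<lbrakk>a \<in> W; a \<notin> below d0\<rbrakk> \<Longrightarrow> infinite {m. g m < h a m}"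
    using unbounded_h[of g] by blast
  \<comment> \<open>For \<open>a\<close> not below \<open>d1\<close>, the function
    \<open>h a\<close> escapes \<open>g\<close> infinitely often, and \<open>below d\<close> lies
    inside \<open>below a\<close>, so that the products of the basis vector at \<open>a\<close> with
    \<open>u m\<close> involve only values of \<open>F a\<close>.\<close>
  obtain d1 where d1: "d1 \<in> W" "d \<in> below d1" "d0 \<in> below d1"
    using countable_subset_below[of "{d, d0}"] d(1) d0(1) by auto
  show ?thesis
  proof (intro bexI[of _ d1] ballI impI)
    fix x
    assume x: "x \<in> perp U" "supp x \<inter> below d1 = {}"
    then have "x \<in> E"
      unfolding perp_def by blast
    then have x_supp: "finite (supp x)" "supp x \<subseteq> W"
      unfolding E_eq by auto
    \<comment> \<open>Sorting puts each earlier row below the current one, as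
      \<open>F_dominates\<close> requires of \<open>c\<close>.\<close>
    obtain xs where xs: "set xs = supp x" "sorted_wrt (\<prec>) xs"
      using finite_sorted_list[OF x_supp] by blast
    have "distinct xs"
      using xs(2) less_asym by (auto simp: distinct_conv_nth sorted_wrt_iff_nth_less)
        (metis linorder_neqE_nat)
    define \<phi> where "\<phi> i c = F (xs ! i) (\<iota> c)" for i c
    have xs_nth: "xs ! i \<in> W" "d \<in> below (xs ! i)" "xs ! i \<notin> below d0" if "i < length xs" for i
    proof -
      have "xs ! i \<in> supp x"
        using that xs(1) nth_mem by blast
      then have *: "xs ! i \<in> W" "xs ! i \<notin> below d1"
        using x_supp x(2) by auto
      show "xs ! i \<in> W"
        by (rule *(1))
      show "d \<in> below (xs ! i)"
        by (rule below_of_not_below[OF *(1) d1(1) *(2) d1(2)])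
      have "d0 \<in> below (xs ! i)"
        by (rule below_of_not_below[OF *(1) d1(1) *(2) d1(3)])
      then show "xs ! i \<notin> below d0"
        using less_asym by (auto simp: below_def)
    qed
    have "\<forall>i<length xs. x (xs ! i) = 0"
    proof (rule g[THEN spec[of _ "length xs"], THEN spec[of _ \<phi>], THEN spec[of _ "\<lambda>i. x (xs ! i)"],
          THEN mp, THEN mp]; intro allI impI conjI)
      fix i
      assume i: "i < length xs"
      note a = xs_nth[OF i]
      show "inj_on (\<phi> i) C"
      proof (rule inj_onI)
        fix c c'
        assume c: "c \<in> C" "c' \<in> C" "\<phi> i c = \<phi> i c'"
        then have "F (xs ! i) (\<iota> c) = F (xs ! i) (\<iota> c')"
          by (simp add: \<phi>_def)
        then have "\<iota> c = \<iota> c'"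
          using subsetD[OF below_mono[OF a(2)] C(1)[OF c(1)]]
            subsetD[OF below_mono[OF a(2)] C(1)[OF c(2)]]
          by (rule inj_onD[OF inj_F[OF a(1)]])
        then have "F d (\<iota> c) = F d (\<iota> c')"
          by (rule arg_cong)
        then show "c = c'"
          by (simp only: C(2) c(1,2))
      qed
      fix n
      \<comment> \<open>The finitely many coordinates where domination fails. Including
        \<open>d\<close> among the \<open>e\<close> provides the bound by \<open>h\<close> even for
        the first row.\<close>
      define X where "X = (\<Union>e\<in>insert d ((!) xs ` {..<i}). {b \<in> below d.
        F (xs ! i) b \<le> h (xs ! i) (F d b)
          + (\<Sum>b'\<in>{b' \<in> below d. F d b' < h (xs ! i) (F d b)}. F e b')})"
      have xs_below: "xs ! j \<in> below (xs ! i)" if "j < i" for j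
        using xs(2) xs_nth(1)[of j] that i by (auto simp: below_def sorted_wrt_iff_nth_less)
      have "finite X"
        unfolding X_def using F_dominates[OF a(1,2)] a(2) xs_below by auto
      then have "finite (insert n (F d ` X))"
        by simp
      then obtain M where M: "\<forall>t\<in>insert n (F d ` X). t < M"
        using finite_nat_set_iff_bounded by blast
      \<comment> \<open>The escape \<open>g m < h (xs ! i) m\<close> is found past the image of
        \<open>X\<close>; monotonicity of \<open>h\<close> carries it to every column
        \<open>c\<close> from \<open>m\<close> on.\<close>
      obtain m where m: "M \<le> m" "g m < h (xs ! i) m"
        using d0(2)[OF a(1,3)] unfolding infinite_nat_iff_unbounded_le by blast
      show "\<exists>m\<ge>n. \<forall>c\<in>C. m \<le> c
        \<longrightarrow> g m \<le> \<phi> i c \<and> (\<forall>j<i. \<forall>c'\<in>C. c' < g m \<longrightarrow> \<phi> j c' < \<phi> i c)"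
      proof (intro exI[of _ m] conjI ballI impI allI)
        show "n \<le> m"
          using M m(1) by auto
        fix c
        assume c: "c \<in> C" "m \<le> c"
        then have "F d (\<iota> c) \<notin> F d ` X"
          using M m(1) C(2) by (metis insertCI leD order.trans less_le_trans)
        then have not_X: "\<iota> c \<notin> X"
          by blast
        have large: "h (xs ! i) c + (\<Sum>b'\<in>{b' \<in> below d. F d b' < h (xs ! i) c}. F e b') < \<phi> i c"
          if "e \<in> insert d ((!) xs ` {..<i})" for e
          using not_X that C[OF c(1)] unfolding X_def \<phi>_def by (auto simp: not_le)
        have g_h: "g m < h (xs ! i) c"
          using m(2) monoD[OF mono_h[OF a(1)] c(2)] by simp
        then show "g m \<le> \<phi> i c"
          using large[of d] by simp
        fix j c'
        assume j: "j < i" and c': "c' \<in> C" "c' < g m"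
        have "\<phi> j c' \<le> (\<Sum>b'\<in>{b' \<in> below d. F d b' < h (xs ! i) c}. F (xs ! j) b')"
          unfolding \<phi>_def using C[OF c'(1)] c'(2) g_h fin_below
          by (intro member_le_sum) auto
        then show "\<phi> j c' < \<phi> i c"
          using large[of "xs ! j"] j by auto
      qed
    next
      fix m
      have "(\<Sum>c\<in>supp (b m). b m c * \<mu> (\<phi> i c)) = (\<Sum>e\<in>supp (u m). u m e * gram (xs ! i) e)"
        if "i < length xs" for i
      proof -
        have "inj_on (F d) (supp (u m))"
          using inj_F[OF d(1)] u_supp(2) by (rule inj_on_subset)
        then have "(\<Sum>c\<in>supp (b m). b m c * \<mu> (\<phi> i c))
            = (\<Sum>e\<in>supp (u m). b m (F d e) * \<mu> (\<phi> i (F d e)))"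
          unfolding supp_b by (simp add: sum.reindex)
        also have "\<dots> = (\<Sum>e\<in>supp (u m). u m e * gram (xs ! i) e)"
        proof (intro sum.cong refl)
          fix e
          assume "e \<in> supp (u m)"
          then have e: "e \<in> below d"
            using u_supp by blast
          then have "e \<prec> xs ! i"
            using below_mono[OF xs_nth(2)[OF that]] by (auto simp: below_def)
          with e show "b m (F d e) * \<mu> (\<phi> i (F d e)) = u m e * gram (xs ! i) e"
            by (simp add: b_def \<phi>_def \<iota> gram_def)
        qed
        finally show ?thesis .
      qed
      then have "(\<Sum>i<length xs. x (xs ! i) * (\<Sum>c\<in>supp (b m). b m c * \<mu> (\<phi> i c)))
          = (\<Sum>i<length xs. x (xs ! i) * (\<Sum>e\<in>supp (u m). u m e * gram (xs ! i) e))"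
        by simp
      also have "\<dots> = (\<Sum>a\<in>supp x. x a * (\<Sum>e\<in>supp (u m). u m e * gram a e))"
        by (rule sum.reindex_bij_betw[OF bij_betw_nth]) (use \<open>distinct xs\<close> xs(1) in auto)
      also have "\<dots> = form x (u m)"
        by (simp add: form_def sum_distrib_left mult.assoc)
      also have "\<dots> = 0"
        using x(1) u(1) span_U by (auto simp: perp_def)
      finally show "(\<Sum>i<length xs. x (xs ! i) * (\<Sum>c\<in>supp (b m). b m c * \<mu> (\<phi> i c))) = 0" .
    qed
    then have "x a = 0" if "a \<in> set xs" for a
      using that unfolding in_set_conv_nth by blast
    then have "x a = 0" for a
      using xs(1) not_in_supp by metis
    then show "x = 0"
      by (simp add: fun_eq_iff)
  qed (rule d1)
qed

section \<open>Dimension count and the Gross property\<close>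

lemma card_dim_E: "card_dim fun_scale E =o |W|"
proof -
  have "card_dim fun_scale E =o |unit_fun ` W :: ('i \<Rightarrow> 'a) set|"
    by (intro fs.card_dim_eq independent_unit_fun) (simp add: E_def fs.span_span)
  also have "|unit_fun ` W :: ('i \<Rightarrow> 'a) set| =o |W|"
    by (rule ordIso_symmetric, rule card_of_ordIsoI[OF inj_on_imp_bij_betw],
        rule inj_on_subset[OF inj_unit_fun subset_UNIV])
  finally show ?thesis .
qed

lemma gross_space: "gross_space fun_scale E form"
proof
  have W: "natLeq <o |W|"
    using uncountable_W not_ordLeq_iff_ordLess[OF natLeq_Well_order card_of_Well_order]
    unfolding countable_card_le_natLeq
    by (metis card_of_Well_order natLeq_Well_order not_ordLeq_iff_ordLess)
  have "infinite W"
    using uncountable_W uncountable_infinite by blast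
  then have "cinfinite |W|"
    by (simp add: cinfinite_def Field_card_of)
  then show "cinfinite (card_dim fun_scale E)"
    by (rule cinfinite_mono[OF ordIso_imp_ordLeq[OF ordIso_symmetric[OF card_dim_E]]])
  fix U :: "('i \<Rightarrow> 'a) set"
  assume U: "fs.subspace U" "U \<subseteq> E" "cinfinite (card_dim fun_scale U)"
  obtain B where B: "B \<subseteq> U" "fs.independent B" "U \<subseteq> fs.span B"
    by (rule fs.maximal_independent_subset)
  have "fs.span B = fs.span U"
    using B fs.span_mono[OF B(1)] fs.span_minimal[OF B(3)] by auto
  then have "card_dim fun_scale U =o |B|"
    by (intro fs.card_dim_eq B)
  then have "cinfinite |B|"
    using cinfinite_mono[OF ordIso_imp_ordLeq U(3)] by blast
  then have "infinite B"
    by (simp add: cinfinite_def Field_card_of)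
  then obtain d where d: "d \<in> W" "\<And>x. \<lbrakk>x \<in> perp U; supp x \<inter> below d = {}\<rbrakk> \<Longrightarrow> x = 0"
    using small_perp[OF U(1,2) B(2) _ B(1)] by blast
  \<comment> \<open>Vectors of the complement that vanish on \<open>below d\<close> are zero, so a
    basis of it is at most as large as this countable set.\<close>
  obtain P where P: "P \<subseteq> perp U" "fs.independent P" "perp U \<subseteq> fs.span P"
    by (rule fs.maximal_independent_subset)
  have span_P: "fs.span P \<subseteq> perp U"
    using P(1) subspace_perp[OF U(2)] by (rule fs.span_minimal)
  have "fs.span P = fs.span (perp U)"
    using P fs.span_mono[OF P(1)] fs.span_minimal[OF P(3)] by auto
  then have "card_dim fun_scale (perp U) =o |P|"
    by (intro fs.card_dim_eq P)
  also have "|P| \<le>o |below d|"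
  proof (rule independent_card_le[OF P(2)])
    have "P \<subseteq> E"
      using P(1) unfolding perp_def by blast
    then show "finite (supp v)" if "v \<in> P" for v
      using that unfolding E_eq by blast
    show "v = 0" if "v \<in> fs.span P" "\<And>i. i \<in> below d \<Longrightarrow> v i = 0" for v
      using that span_P by (intro d(2)) (auto simp: supp_def)
  qed
  also have "|below d| \<le>o natLeq"
    using countable_below[OF d(1)] by (simp add: countable_card_le_natLeq)
  also note W
  also have "|W| =o card_dim fun_scale E"
    by (rule ordIso_symmetric[OF card_dim_E])
  finally show "card_dim fun_scale (perp U) <o card_dim fun_scale E" .
qed

end

theorem mainTheorem2:
  assumes "bounding_number =o aleph1"
    and "infinite (UNIV :: 'f::field set)"
  shows "\<exists>(E :: (nat set \<Rightarrow> 'f) set) \<Phi>.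
    gross_space fun_scale E \<Phi> \<and> card_dim fun_scale E =o aleph1"
proof -
  interpret omega1_order "Field aleph1" "\<lambda>a b. (a, b) \<in> aleph1 - Id"
    by (rule omega1_order_aleph1)
  have aleph1: "|Field aleph1| =o aleph1"
    unfolding aleph1_def by (intro card_of_Field_ordIso cardSuc_Card_order natLeq_Card_order)
  obtain \<F> where \<F>: "unbounded_family \<F>" "bounding_number = |\<F>|"
    using bounding_number_minimal(1) by blast
  then have "|Field aleph1| =o |\<F>|"
    using assms(1) aleph1 ordIso_symmetric ordIso_transitive by metis
  \<comment> \<open>Here the hypothesis on the bounding number enters: an unbounded family can be
    indexed by the order of type \<open>\<omega>\<^sub>1\<close>.\<close>
  then obtain k where k: "bij_betw k (Field aleph1) \<F>"
    unfolding card_of_ordIso[symmetric] by blast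
  obtain h where h: "\<And>a. a \<in> Field aleph1 \<Longrightarrow> mono (h a)"
    "\<And>g :: nat \<Rightarrow> nat. \<exists>d\<in>Field aleph1. \<forall>a\<in>Field aleph1. a \<notin> below d \<longrightarrow> infinite {m. g m < h a m}"
    using monotone_unbounded_family[OF k \<F>(1)] by blast
  obtain F where F: "\<And>a. a \<in> Field aleph1 \<Longrightarrow> inj_on (F a) (below a)"
    "\<And>a d c. \<lbrakk>a \<in> Field aleph1; d \<in> below a; c \<in> below a\<rbrakk> \<Longrightarrow> finite {b \<in> below d.
        F a b \<le> h a (F d b) + (\<Sum>b'\<in>{b' \<in> below d. F d b' < h a (F d b)}. F c b')}"
    using dominating_injections[of h] by blast
  obtain \<mu> :: "nat \<Rightarrow> 'f" where \<mu>: "\<And>p v. p \<in> poly_fun \<Longrightarrow> \<exists>N. \<forall>n\<ge>N. \<forall>\<tau>.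
      (\<forall>w. w \<noteq> v \<longrightarrow> \<tau> w < n) \<longrightarrow> finite {z. p ((\<mu> \<circ> \<tau>)(v := z)) = 0}
        \<longrightarrow> p ((\<mu> \<circ> \<tau>)(v := \<mu> n)) \<noteq> 0"
    using generic_sequence_exists[OF assms(2)] by meson
  interpret omega1_form "Field aleph1" "\<lambda>a b. (a, b) \<in> aleph1 - Id" \<mu> h F
    using \<mu> h F by unfold_locales
  have "card_dim fun_scale E =o aleph1"
    using card_dim_E aleph1 by (rule ordIso_transitive)
  with gross_space show ?thesis
    by blast
qed

end
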